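(* Let $\Gamma$ be a nonempty set and let $\mathcal{S}$ be a countably intersected family of subsets of $\Gamma$. Then the Banach space $J\mathcal{S}$ does not contain a subspace isomorphic to $\ell^{1}(\mathbb{N})$.
   Context: A family $\mathcal{S}$ of subsets of $\Gamma$ is countably intersected (C.I.) if: (a) $\mathcal{S}$ consists of countable subsets of $\Gamma$, contains all singletons, and is pointwise closed, i.e. $\{\chi_s : s\in\mathcal{S}\}$ is closed in $\{0,1\}^{\Gamma}$ with the product topology; (b) for all $s,t\in\mathcal{S}$, the set $s\setminus t$ is a finite union of pairwise disjoint elements of $\mathcal{S}$; (c) to every $t\in\mathcal{S}$ one can assign $s_t\in\mathcal{S}$ with $t\subseteq s_t$ such that for all $s,t_1,\dots,t_n\in\mathcal{S}$ there exists $t\in\mathcal{S}$ with $t\subseteq s\setminus\bigcup_{i=1}^n s_{t_i}$ and $s\setminus\big(\bigcup_{i=1}^n s_{t_i}\cup t\big)$ finite; (d) for every $s\in\mathcal{S}$ the set $\{s\cap t: t\in\mathcal{S}\}$ is countable. For a family $\mathcal{S}$ of subsets of $\Gamma$ and a finitely supported function $\phi:\Gamma\to\mathbb{R}$, the James-$\mathcal{S}$ norm is $\|\phi\|=\sup\big(\sum_{i=1}^n(\sum_{a\in s_i}\phi(a))^2\big)^{1/2}$, the supremum over all finite families $\{s_1,\dots,s_n\}$ of pairwise disjoint elements of $\mathcal{S}$. $J\mathcal{S}$ denotes the completion of the space of finitely supported real functions on $\Gamma$ in this norm. *)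

theory Defs
  imports "HOL-Analysis.Analysis"
begin

text \<open>The ground set Gamma is the (nonempty) universe of the type 'a.\<close>

definition countably_intersected :: "'a set set \<Rightarrow> bool" where
  "countably_intersected S \<longleftrightarrow>
     \<comment> \<open>(a)\<close>
     (\<forall>s\<in>S. countable s) \<and> (\<forall>a. {a} \<in> S) \<and>
     closed ((\<lambda>s. indicator s :: 'a \<Rightarrow> real) ` S) \<and>
     \<comment> \<open>(b)\<close>
     (\<forall>s\<in>S. \<forall>t\<in>S. \<exists>F. finite F \<and> F \<subseteq> S \<and> disjoint F \<and> s - t = \<Union>F) \<and>
     \<comment> \<open>(c)\<close>
     (\<exists>\<sigma> :: 'a set \<Rightarrow> 'a set. (\<forall>t\<in>S. \<sigma> t \<in> S \<and> t \<subseteq> \<sigma> t) \<and>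
        (\<forall>s\<in>S. \<forall>T. finite T \<and> T \<subseteq> S \<longrightarrow>
           (\<exists>t\<in>S. t \<subseteq> s - \<Union>(\<sigma> ` T) \<and> finite (s - (\<Union>(\<sigma> ` T) \<union> t))))) \<and>
     \<comment> \<open>(d)\<close>
     (\<forall>s\<in>S. countable {s \<inter> t | t. t \<in> S})"

definition fin_supp :: "('a \<Rightarrow> real) set" where
  "fin_supp = {\<phi>. finite {a. \<phi> a \<noteq> 0}}"

definition set_sum :: "('a \<Rightarrow> real) \<Rightarrow> 'a set \<Rightarrow> real" where
  "set_sum \<phi> s = (\<Sum>a \<in> s \<inter> {a. \<phi> a \<noteq> 0}. \<phi> a)"

definition james_norm :: "'a set set \<Rightarrow> ('a \<Rightarrow> real) \<Rightarrow> real" where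
  "james_norm S \<phi> = sqrt (SUP F \<in> {F. finite F \<and> F \<subseteq> S \<and> disjoint F}.
                              (\<Sum>s\<in>F. (set_sum \<phi> s)\<^sup>2))"

definition is_james_completion ::
    "'a set set \<Rightarrow> (('a \<Rightarrow> real) \<Rightarrow> 'b::banach) \<Rightarrow> bool" where
  "is_james_completion S T \<longleftrightarrow>
     (\<forall>\<phi>\<in>fin_supp. \<forall>\<psi>\<in>fin_supp. T (\<lambda>a. \<phi> a + \<psi> a) = T \<phi> + T \<psi>) \<and>
     (\<forall>\<phi>\<in>fin_supp. \<forall>r. T (\<lambda>a. r * \<phi> a) = r *\<^sub>R T \<phi>) \<and>
     (\<forall>\<phi>\<in>fin_supp. norm (T \<phi>) = james_norm S \<phi>) \<and>
     closure (T ` fin_supp) = UNIV"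

definition l1 :: "(nat \<Rightarrow> real) set" where
  "l1 = {a. summable (\<lambda>n. \<bar>a n\<bar>)}"

definition l1_norm :: "(nat \<Rightarrow> real) \<Rightarrow> real" where
  "l1_norm a = (\<Sum>n. \<bar>a n\<bar>)"

definition contains_l1 :: "'b::real_normed_vector itself \<Rightarrow> bool" where
  "contains_l1 _ \<longleftrightarrow> (\<exists>U :: (nat \<Rightarrow> real) \<Rightarrow> 'b.
     (\<forall>a\<in>l1. \<forall>b\<in>l1. U (\<lambda>n. a n + b n) = U a + U b) \<and>
     (\<forall>a\<in>l1. \<forall>r. U (\<lambda>n. r * a n) = r *\<^sub>R U a) \<and>
     (\<exists>c>0. \<exists>C. \<forall>a\<in>l1. c * l1_norm a \<le> norm (U a) \<and> norm (U a) \<le> C * l1_norm a))"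

end

theory Submission
  imports Defs "HOL-Library.Diagonal_Subsequence"
begin

text \<open>
  Suppose \<open>J S\<close> contains \<open>\<ell>\<^sup>1\<close>. After a perturbation, finitely supported vectors \<open>x\<^sub>n\<close> span it.
  Each \<open>s \<in> S\<close> gives a functional \<open>s\<^sup>*\<close> of norm at most 1, and disjoint members of \<open>S\<close> on which the
  \<open>x\<^sub>n\<close> stay large are boundedly many, so (c) reduces the convergence of \<open>s\<^sup>*(x\<^sub>n)\<close> to the traces of \<open>S\<close>
  on finitely many members of \<open>S\<close>. By (d) these are countably many, and a diagonal subsequence makes \<open>s\<^sup>*(x\<^sub>n)\<close>
  converge for every \<open>s\<close>. Differences \<open>y\<^sub>k\<close> then satisfy \<open>s\<^sup>*(y\<^sub>k) \<longlonglongrightarrow> 0\<close> for every \<open>s\<close>, and by compactness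
  of \<open>S\<close> and the Simons inequality, convex combinations \<open>z\<close> of them are uniformly small on \<open>S\<close>.
  If each \<open>z\<^sub>n\<close> is small enough compared with the support of \<open>z\<^sub>1 + \<dots> + z\<^bsub>n-1\<^esub>\<close>, the norm of
  \<open>z\<^sub>1 + \<dots> + z\<^sub>n\<close> is of order \<open>sqrt n\<close>, against the lower bound \<open>c n\<close> in \<open>\<ell>\<^sup>1\<close>.
\<close>

section \<open>The James norm on finitely supported functions\<close>

text \<open>The range of summation in \<open>set_sum\<close> depends on the function through its
  support; a common finite superset lets different functions be added term by term.\<close>

lemma set_sum_eq_sum:
  assumes "finite A" "{a. \<phi> a \<noteq> 0} \<subseteq> A"
  shows "set_sum \<phi> s = (\<Sum>a\<in>s \<inter> A. \<phi> a)"
  unfolding set_sum_def using assms by (intro sum.mono_neutral_left) auto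

lemma fin_supp_add: "\<phi> \<in> fin_supp \<Longrightarrow> \<psi> \<in> fin_supp \<Longrightarrow> (\<lambda>a. \<phi> a + \<psi> a) \<in> fin_supp"
  unfolding fin_supp_def
  by (auto intro: finite_subset[of _ "{a. \<phi> a \<noteq> 0} \<union> {a. \<psi> a \<noteq> 0}"])

lemma fin_supp_scale: "\<phi> \<in> fin_supp \<Longrightarrow> (\<lambda>a. r * \<phi> a) \<in> fin_supp"
  unfolding fin_supp_def by (auto intro: finite_subset[of _ "{a. \<phi> a \<noteq> 0}"])

lemma fin_supp_diff: "\<phi> \<in> fin_supp \<Longrightarrow> \<psi> \<in> fin_supp \<Longrightarrow> (\<lambda>a. \<phi> a - \<psi> a) \<in> fin_supp"
  using fin_supp_add[of \<phi> "\<lambda>a. -1 * \<psi> a"] fin_supp_scale[of \<psi> "-1"] by simp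

lemma set_sum_add:
  assumes "\<phi> \<in> fin_supp" "\<psi> \<in> fin_supp"
  shows "set_sum (\<lambda>a. \<phi> a + \<psi> a) s = set_sum \<phi> s + set_sum \<psi> s"
proof -
  let ?A = "{a. \<phi> a \<noteq> 0} \<union> {a. \<psi> a \<noteq> 0}"
  have A: "finite ?A"
    using assms by (simp add: fin_supp_def)
  have "{a. \<phi> a + \<psi> a \<noteq> 0} \<subseteq> ?A" by auto
  then show ?thesis
    using A by (simp add: set_sum_eq_sum[of ?A] sum.distrib)
qed

lemma set_sum_scale: "set_sum (\<lambda>a. r * \<phi> a) s = r * set_sum \<phi> s"
  by (cases "r = 0") (simp_all add: set_sum_def sum_distrib_left)

lemma set_sum_diff:
  assumes "\<phi> \<in> fin_supp" "\<psi> \<in> fin_supp"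
  shows "set_sum (\<lambda>a. \<phi> a - \<psi> a) s = set_sum \<phi> s - set_sum \<psi> s"
  using set_sum_add[OF assms(1) fin_supp_scale[OF assms(2)], of "-1" s] set_sum_scale[of "-1" \<psi> s]
  by simp

lemma set_sum_Un:
  assumes "\<phi> \<in> fin_supp" "s \<inter> t = {}"
  shows "set_sum \<phi> (s \<union> t) = set_sum \<phi> s + set_sum \<phi> t"
  using assms unfolding set_sum_def fin_supp_def
  by (subst sum.union_disjoint[symmetric]) (auto intro!: sum.cong)

lemma set_sum_finite: "finite s \<Longrightarrow> set_sum \<phi> s = (\<Sum>a\<in>s. \<phi> a)"
  unfolding set_sum_def by (intro sum.mono_neutral_left) auto

lemma set_sum_disjoint_support: "s \<inter> {a. \<phi> a \<noteq> 0} = {} \<Longrightarrow> set_sum \<phi> s = 0"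
  by (simp add: set_sum_def)

text \<open>Picking a point of \<open>A\<close> in each member is injective by disjointness. With
  \<open>A\<close> a support, this bounds how many members of a disjoint family can contribute to a
  sum.\<close>

lemma card_disjoint_meeting_le:
  assumes "finite A" "disjoint F" "\<And>s. s \<in> F \<Longrightarrow> s \<inter> A \<noteq> {}"
  shows "card F \<le> card A"
proof -
  define f where "f s = (SOME a. a \<in> s \<inter> A)" for s
  have f: "f s \<in> s \<inter> A" if "s \<in> F" for s
    unfolding f_def using assms(3)[OF that] by (simp only: some_in_eq) simp
  have "inj_on f F"
  proof (rule inj_onI, rule ccontr)
    fix s t assume "s \<in> F" "t \<in> F" "f s = f t" "s \<noteq> t"
    then have "s \<inter> t = {}" "f s \<in> s" "f s \<in> t"
      using f[of s] f[of t] disjointD[OF assms(2)] by auto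
    then show False by auto
  qed
  moreover have "f ` F \<subseteq> A" using f by auto
  ultimately show ?thesis
    using assms(1) by (auto intro: card_inj_on_le)
qed

text \<open>A real supremum carries information only for a set bounded above. At most
  \<open>card ?A\<close> members meet the support, and each contributes at most the square of the
  sum of all absolute values.\<close>

lemma bdd_above_james:
  assumes "\<phi> \<in> fin_supp"
  shows "bdd_above ((\<lambda>F. \<Sum>s\<in>F. (set_sum \<phi> s)\<^sup>2) ` {F. finite F \<and> F \<subseteq> S \<and> disjoint F})"
proof -
  let ?A = "{a. \<phi> a \<noteq> 0}"
  let ?B = "\<Sum>a\<in>?A. \<bar>\<phi> a\<bar>"
  have A: "finite ?A" using assms by (simp add: fin_supp_def)
  have le: "\<bar>set_sum \<phi> s\<bar> \<le> ?B" for s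
  proof -
    have "\<bar>set_sum \<phi> s\<bar> \<le> (\<Sum>a\<in>s \<inter> ?A. \<bar>\<phi> a\<bar>)"
      unfolding set_sum_def by (rule sum_abs)
    also have "\<dots> \<le> ?B" using A by (intro sum_mono2) auto
    finally show ?thesis .
  qed
  have "(\<Sum>s\<in>F. (set_sum \<phi> s)\<^sup>2) \<le> card ?A * ?B\<^sup>2" if F: "finite F" "disjoint F" for F
  proof -
    let ?G = "{s \<in> F. s \<inter> ?A \<noteq> {}}"
    have "disjoint ?G" using F(2) by (rule pairwise_subset) auto
    then have G: "card ?G \<le> card ?A"
      by (rule card_disjoint_meeting_le[OF A]) simp
    have "(\<Sum>s\<in>F. (set_sum \<phi> s)\<^sup>2) = (\<Sum>s\<in>?G. (set_sum \<phi> s)\<^sup>2)"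
      using F(1) by (intro sum.mono_neutral_right) (auto simp: set_sum_disjoint_support)
    also have "\<dots> \<le> (\<Sum>s\<in>?G. ?B\<^sup>2)"
      by (rule sum_mono, rule iffD1[OF abs_le_square_iff]) (rule order_trans[OF le abs_ge_self])
    also have "\<dots> \<le> card ?A * ?B\<^sup>2"
      using G by (simp add: mult_right_mono[of _ _ "?B\<^sup>2"])
    finally show ?thesis .
  qed
  then show ?thesis by (intro bdd_aboveI2[where M = "card ?A * ?B\<^sup>2"]) simp
qed

lemma james_norm_square:
  assumes "\<phi> \<in> fin_supp"
  shows "(james_norm S \<phi>)\<^sup>2 = (SUP F \<in> {F. finite F \<and> F \<subseteq> S \<and> disjoint F}. \<Sum>s\<in>F. (set_sum \<phi> s)\<^sup>2)"
proof -
  \<comment> \<open>The empty family has value 0, so the supremum is nonnegative and squaring undoes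
    the root.\<close>
  have "0 \<le> (SUP F \<in> {F. finite F \<and> F \<subseteq> S \<and> disjoint F}. \<Sum>s\<in>F. (set_sum \<phi> s)\<^sup>2)"
    using cSUP_upper[OF _ bdd_above_james[OF assms], of "{}"] by simp
  then show ?thesis by (simp add: james_norm_def)
qed

lemma sum_squares_le_james:
  assumes "\<phi> \<in> fin_supp" "finite F" "F \<subseteq> S" "disjoint F"
  shows "(\<Sum>s\<in>F. (set_sum \<phi> s)\<^sup>2) \<le> (james_norm S \<phi>)\<^sup>2"
  unfolding james_norm_square[OF assms(1)]
  using assms by (intro cSUP_upper bdd_above_james) auto

lemma james_norm_square_le:
  assumes "\<phi> \<in> fin_supp"
    and "\<And>F. finite F \<Longrightarrow> F \<subseteq> S \<Longrightarrow> disjoint F \<Longrightarrow> (\<Sum>s\<in>F. (set_sum \<phi> s)\<^sup>2) \<le> B"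
  shows "(james_norm S \<phi>)\<^sup>2 \<le> B"
  unfolding james_norm_square[OF assms(1)]
  using assms(2) by (intro cSUP_least) (auto intro: exI[of _ "{}"])

lemma james_norm_nonneg: "\<phi> \<in> fin_supp \<Longrightarrow> 0 \<le> james_norm S \<phi>"
  using cSUP_upper[OF _ bdd_above_james, of "{}" S \<phi>] by (simp add: james_norm_def)

text \<open>The family with the single member \<open>s\<close> is admissible; this is the norm bound
  1 for \<open>s\<^sup>*\<close>.\<close>

lemma abs_set_sum_le_james:
  assumes "\<phi> \<in> fin_supp" "s \<in> S"
  shows "\<bar>set_sum \<phi> s\<bar> \<le> james_norm S \<phi>"
  using sum_squares_le_james[OF assms(1), of "{s}" S] assms(2) james_norm_nonneg[OF assms(1)]
  by (simp add: abs_le_square_iff[symmetric])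

text \<open>Only the at most \<open>card (supp w)\<close> members of a disjoint family that meet the support
  of \<open>w\<close> contribute to the mixed terms of the square.\<close>

lemma james_norm_square_add_le:
  assumes w: "w \<in> fin_supp" and z: "z \<in> fin_supp"
    and "0 \<le> \<delta>" and \<delta>: "\<And>s. s \<in> S \<Longrightarrow> \<bar>set_sum z s\<bar> \<le> \<delta>"
  shows "(james_norm S (\<lambda>a. w a + z a))\<^sup>2
    \<le> (james_norm S w)\<^sup>2 + (james_norm S z)\<^sup>2 + 2 * card {a. w a \<noteq> 0} * (james_norm S w * \<delta>)"
proof (rule james_norm_square_le[OF fin_supp_add[OF w z]])
  fix F assume F: "finite F" "F \<subseteq> S" "disjoint F"
  let ?A = "{a. w a \<noteq> 0}"
  let ?G = "{s \<in> F. s \<inter> ?A \<noteq> {}}"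
  have A: "finite ?A" using w by (simp add: fin_supp_def)
  have "disjoint ?G" using F(3) by (rule pairwise_subset) auto
  then have G: "card ?G \<le> card ?A"
    by (rule card_disjoint_meeting_le[OF A]) simp
  have mixed: "set_sum w s * set_sum z s \<le> james_norm S w * \<delta>" if "s \<in> F" for s
  proof -
    have "set_sum w s * set_sum z s \<le> \<bar>set_sum w s\<bar> * \<bar>set_sum z s\<bar>"
      by (simp flip: abs_mult)
    also have "\<dots> \<le> james_norm S w * \<delta>"
      using that F(2) \<delta> abs_set_sum_le_james[OF w] james_norm_nonneg[OF w]
      by (intro mult_mono) auto
    finally show ?thesis .
  qed
  have "(\<Sum>s\<in>F. set_sum w s * set_sum z s) \<le> card ?A * (james_norm S w * \<delta>)"
  proof -
    have nn: "0 \<le> james_norm S w * \<delta>" using james_norm_nonneg[OF w] \<open>0 \<le> \<delta>\<close> by simp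
    have "(\<Sum>s\<in>F. set_sum w s * set_sum z s) = (\<Sum>s\<in>?G. set_sum w s * set_sum z s)"
      using F(1) by (intro sum.mono_neutral_right) (auto simp: set_sum_disjoint_support)
    also have "\<dots> \<le> (\<Sum>s\<in>?G. james_norm S w * \<delta>)"
      using mixed by (intro sum_mono) auto
    also have "\<dots> \<le> card ?A * (james_norm S w * \<delta>)"
      using G nn by (simp add: mult_right_mono)
    finally show ?thesis .
  qed
  moreover have "(\<Sum>s\<in>F. (set_sum (\<lambda>a. w a + z a) s)\<^sup>2) = (\<Sum>s\<in>F. (set_sum w s)\<^sup>2)
      + (\<Sum>s\<in>F. (set_sum z s)\<^sup>2) + 2 * (\<Sum>s\<in>F. set_sum w s * set_sum z s)"
    by (simp add: set_sum_add[OF w z] power2_sum sum.distrib sum_distrib_left mult.assoc)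
  ultimately show "(\<Sum>s\<in>F. (set_sum (\<lambda>a. w a + z a) s)\<^sup>2)
    \<le> (james_norm S w)\<^sup>2 + (james_norm S z)\<^sup>2 + 2 * card {a. w a \<noteq> 0} * (james_norm S w * \<delta>)"
    using sum_squares_le_james[OF w F] sum_squares_le_james[OF z F] by linarith
qed

section \<open>Subsequences converging on every member of the family\<close>

text \<open>Bolzano-Weierstrass for one index at a time, then a diagonal argument along an
  enumeration of \<open>I\<close>.\<close>

lemma convergent_subseq_family:
  fixes f :: "'i \<Rightarrow> nat \<Rightarrow> real"
  assumes "countable I" and bnd: "\<And>i. i \<in> I \<Longrightarrow> bounded (range (f i))"
  obtains r :: "nat \<Rightarrow> nat" where "strict_mono r" "\<And>i. i \<in> I \<Longrightarrow> convergent (f i \<circ> r)"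
proof (cases "I = {}")
  case True
  then show ?thesis using that[of id] by (simp add: strict_mono_def)
next
  case False
  define P where "P n s \<longleftrightarrow> convergent (f (from_nat_into I n) \<circ> s)" for n and s :: "nat \<Rightarrow> nat"
  interpret subseqs P
  proof
    fix n and s :: "nat \<Rightarrow> nat"
    have "bounded (range (f (from_nat_into I n)))"
      using bnd from_nat_into[OF False] by blast
    then have "bounded (range (f (from_nat_into I n) \<circ> s))"
      by (rule bounded_subset) auto
    then obtain l r where "strict_mono r" "((f (from_nat_into I n) \<circ> s) \<circ> r) \<longlonglongrightarrow> l"
      by (metis bounded_imp_convergent_subsequence)
    then show "\<exists>r. strict_mono r \<and> P n (s \<circ> r)"
      unfolding P_def by (auto simp: convergent_def comp_assoc)
  qed
  \<comment> \<open>From term \<open>Suc k\<close> on, the diagonal sequence is a subsequence of the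
    one chosen at stage \<open>k\<close>, and initial terms do not affect convergence.\<close>
  have *: "P k (diagseq \<circ> ((+) (Suc k)))" for k
  proof (rule diagseq_holds)
    fix r s :: "nat \<Rightarrow> nat" and n assume "strict_mono r" "P n s"
    then show "P n (s \<circ> r)"
      using convergent_subseq_convergent[of "f (from_nat_into I n) \<circ> s" r]
      by (simp add: P_def comp_assoc)
  qed
  have "convergent (f i \<circ> diagseq)" if i: "i \<in> I" for i
  proof -
    obtain k where "from_nat_into I k = i"
      using from_nat_into_surj[OF assms(1) i] by blast
    then have "convergent (\<lambda>n. (f i \<circ> diagseq) (n + Suc k))"
      using *[of k] by (simp add: P_def comp_def add.commute)
    then show ?thesis by (subst (asm) convergent_ignore_initial_segment)
  qed
  then show ?thesis using that subseq_diagseq by blast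
qed

text \<open>A maximal disjoint family of sets on which some subsequence stays away from 0 is finite
  by the bound on sums of squares; every set avoiding its hull is small in the limit.\<close>

lemma finite_family_small_off:
  fixes f :: "'a set \<Rightarrow> nat \<Rightarrow> real"
  assumes \<sigma>: "\<And>t. t \<in> S \<Longrightarrow> t \<subseteq> \<sigma> t"
    and bnd: "\<And>F n. finite F \<Longrightarrow> F \<subseteq> S \<Longrightarrow> disjoint F \<Longrightarrow> (\<Sum>s\<in>F. (f s n)\<^sup>2) \<le> B"
    and empty: "\<And>n. f {} n = 0" and "\<epsilon> > 0"
  obtains T and r :: "nat \<Rightarrow> nat" where "finite T" "T \<subseteq> S" "strict_mono r"
    "\<And>t. t \<in> S \<Longrightarrow> t \<inter> \<Union>(\<sigma> ` T) = {} \<Longrightarrow> \<forall>\<^sub>F n in sequentially. \<bar>f t (r n)\<bar> \<le> \<epsilon>"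
proof -
  define Q where "Q T r \<longleftrightarrow> finite T \<and> T \<subseteq> S \<and> disjoint T \<and> strict_mono r \<and> (\<forall>t\<in>T. \<forall>n. \<epsilon> < \<bar>f t (r n)\<bar>)"
    for T and r :: "nat \<Rightarrow> nat"
  \<comment> \<open>At index \<open>r 0\<close> every member of \<open>T\<close> contributes at
    least \<open>\<epsilon>\<^sup>2\<close> to a sum of squares bounded by \<open>B\<close>. The
    size of \<open>T\<close> is thus bounded uniformly, and a largest \<open>T\<close>
    exists.\<close>
  have card: "card T < Suc (nat \<lceil>B / \<epsilon>\<^sup>2\<rceil>)" if ex: "\<exists>r. Q T r" for T
  proof -
    obtain r where r: "Q T r" using ex by blast
    have "card T * \<epsilon>\<^sup>2 = (\<Sum>t\<in>T. \<epsilon>\<^sup>2)" by simp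
    also have "\<dots> \<le> (\<Sum>t\<in>T. (f t (r 0))\<^sup>2)"
    proof (rule sum_mono)
      fix t assume "t \<in> T"
      then have "\<epsilon> < \<bar>f t (r 0)\<bar>" using r by (auto simp: Q_def)
      then show "\<epsilon>\<^sup>2 \<le> (f t (r 0))\<^sup>2"
        using \<open>\<epsilon> > 0\<close> by (intro iffD1[OF abs_le_square_iff]) simp
    qed
    also have "\<dots> \<le> B" using r bnd by (simp add: Q_def)
    finally have "card T \<le> B / \<epsilon>\<^sup>2" using \<open>\<epsilon> > 0\<close> by (simp add: pos_le_divide_eq)
    then show ?thesis by linarith
  qed
  have "Q {} id" by (simp add: Q_def strict_mono_def)
  then have "\<exists>T. (\<exists>r. Q T r) \<and> (\<forall>U. (\<exists>r. Q U r) \<longrightarrow> card U \<le> card T)"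
    using card by (intro ex_has_greatest_nat[where k = "{}" and b = "Suc (nat \<lceil>B / \<epsilon>\<^sup>2\<rceil>)"]) auto
  then obtain T r where Q: "Q T r" and max: "\<And>U r'. Q U r' \<Longrightarrow> card U \<le> card T" by blast
  have "\<forall>\<^sub>F n in sequentially. \<bar>f t (r n)\<bar> \<le> \<epsilon>" if t: "t \<in> S" "t \<inter> \<Union>(\<sigma> ` T) = {}" for t
  proof (rule ccontr)
    assume "\<not> ?thesis"
    then have "infinite {n. \<epsilon> < \<bar>f t (r n)\<bar>}"
      by (simp add: not_eventually frequently_cofinite[symmetric] cofinite_eq_sequentially not_le)
    then obtain q :: "nat \<Rightarrow> nat" where q: "strict_mono q" "\<And>n. \<epsilon> < \<bar>f t (r (q n))\<bar>"
      using infinite_enumerate by (metis mem_Collect_eq)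
    \<comment> \<open>The empty set is disjoint from itself and could already lie in
      \<open>T\<close>. Only a nonempty \<open>t\<close> disjoint from all members of
      \<open>T\<close> is sure to be new and to contradict maximality.\<close>
    have "t \<noteq> {}" using q(2)[of 0] \<open>\<epsilon> > 0\<close> empty by auto
    have dis: "t \<inter> u = {}" if "u \<in> T" for u
      using that t(2) \<sigma>[of u] Q by (auto simp: Q_def)
    then have "t \<notin> T" using \<open>t \<noteq> {}\<close> by blast
    have "disjoint (insert t T)"
      using Q dis unfolding pairwise_insert disjnt_def Q_def by blast
    moreover have "strict_mono (r \<circ> q)"
      using Q q(1) by (auto simp: Q_def intro: strict_mono_o)
    ultimately have "Q (insert t T) (r \<circ> q)"
      using Q q(2) t(1) by (simp add: Q_def)
    then have "card (insert t T) \<le> card T" by (rule max)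
    then show False using Q \<open>t \<notin> T\<close> by (simp add: Q_def)
  qed
  then show ?thesis using that Q by (auto simp: Q_def)
qed

text \<open>The comparison sequence may change with \<open>\<epsilon>\<close>, so no candidate for
  the limit is at hand; the Cauchy criterion does without one.\<close>

lemma convergent_if_eventually_close:
  fixes u :: "nat \<Rightarrow> real"
  assumes "\<And>\<epsilon>. \<epsilon> > 0 \<Longrightarrow> \<exists>v. convergent v \<and> (\<forall>\<^sub>F n in sequentially. \<bar>u n - v n\<bar> \<le> \<epsilon>)"
  shows "convergent u"
proof -
  have "Cauchy u"
  proof (rule metric_CauchyI)
    fix e :: real assume "e > 0"
    then obtain v where v: "convergent v" "\<forall>\<^sub>F n in sequentially. \<bar>u n - v n\<bar> \<le> e / 4"
      using assms[of "e / 4"] by auto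
    obtain M where M: "\<And>m n. m \<ge> M \<Longrightarrow> n \<ge> M \<Longrightarrow> dist (v m) (v n) < e / 4"
      using metric_CauchyD[OF convergent_Cauchy[OF v(1)], of "e / 4"] \<open>e > 0\<close> by auto
    obtain N where N: "\<And>n. n \<ge> N \<Longrightarrow> \<bar>u n - v n\<bar> \<le> e / 4"
      using v(2) unfolding eventually_sequentially by blast
    show "\<exists>M. \<forall>m\<ge>M. \<forall>n\<ge>M. dist (u m) (u n) < e"
    proof (intro exI[of _ "max M N"] allI impI)
      fix m n assume "m \<ge> max M N" "n \<ge> max M N"
      then have "\<bar>v m - v n\<bar> < e / 4" "\<bar>u m - v m\<bar> \<le> e / 4" "\<bar>u n - v n\<bar> \<le> e / 4"
        using M[of m n] N[of m] N[of n] by (simp_all add: dist_real_def)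
      then show "dist (u m) (u n) < e"
        using \<open>e > 0\<close> unfolding dist_real_def by linarith
    qed
  qed
  then show ?thesis by (rule Cauchy_convergent)
qed

text \<open>The trace of \<open>s\<close> on a union is the union of its traces on the members, so
  it is determined by finitely many choices from countable sets.\<close>

lemma countable_Int_Union:
  assumes "finite G" "\<And>t. t \<in> G \<Longrightarrow> countable {s \<inter> t | s. s \<in> S}"
  shows "countable {s \<inter> \<Union>G | s. s \<in> S}"
  using assms
proof (induction G)
  case empty
  have "{s \<inter> \<Union>{} | s. s \<in> S} \<subseteq> {{}}" by auto
  then show ?case by (rule countable_subset) simp
next
  case (insert t G)
  have "{s \<inter> \<Union>(insert t G) | s. s \<in> S}
      \<subseteq> (\<lambda>(a, b). a \<union> b) ` ({s \<inter> t | s. s \<in> S} \<times> {s \<inter> \<Union>G | s. s \<in> S})"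
  proof
    fix u assume "u \<in> {s \<inter> \<Union>(insert t G) | s. s \<in> S}"
    then obtain s where "s \<in> S" "u = (\<lambda>(a, b). a \<union> b) (s \<inter> t, s \<inter> \<Union>G)" by auto
    then show "u \<in> (\<lambda>(a, b). a \<union> b) ` ({s \<inter> t | s. s \<in> S} \<times> {s \<inter> \<Union>G | s. s \<in> S})"
      by (intro image_eqI[where x = "(s \<inter> t, s \<inter> \<Union>G)"]) auto
  qed
  moreover have "countable ({s \<inter> t | s. s \<in> S} \<times> {s \<inter> \<Union>G | s. s \<in> S})"
    using insert.prems insert.IH by (intro countable_SIGMA) simp_all
  ultimately show ?case using countable_image countable_subset by meson
qed

text \<open>Let \<open>U\<close> be the union of the hulls of a finite family \<open>T\<close>. By
  (c), \<open>s\<close> splits into its trace on \<open>U\<close>, a member \<open>t\<close> of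
  \<open>S\<close> avoiding \<open>U\<close>, and a finite set. The traces are countably many by
  (d), \<open>t\<close> is small if \<open>T\<close> comes from
  \<open>finite_family_small_off\<close>, and the finite set needs only convergence at
  points.\<close>

lemma pointwise_convergent_subseq:
  fixes x :: "nat \<Rightarrow> 'a \<Rightarrow> real"
  assumes CI: "countably_intersected S" and x: "\<And>n. x n \<in> fin_supp"
    and B: "\<And>n. james_norm S (x n) \<le> B"
  obtains r :: "nat \<Rightarrow> nat" where "strict_mono r"
    "\<And>s. s \<in> S \<Longrightarrow> convergent (\<lambda>n. set_sum (x (r n)) s)"
proof -
  have "\<exists>\<sigma>. (\<forall>t\<in>S. \<sigma> t \<in> S \<and> t \<subseteq> \<sigma> t) \<and>
      (\<forall>s\<in>S. \<forall>T. finite T \<and> T \<subseteq> S \<longrightarrow>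
         (\<exists>t\<in>S. t \<subseteq> s - \<Union>(\<sigma> ` T) \<and> finite (s - (\<Union>(\<sigma> ` T) \<union> t))))"
    using CI unfolding countably_intersected_def by (elim conjE)
  then obtain \<sigma> where \<sigma>: "\<forall>t\<in>S. \<sigma> t \<in> S \<and> t \<subseteq> \<sigma> t"
    and c': "\<forall>s\<in>S. \<forall>T. finite T \<and> T \<subseteq> S \<longrightarrow>
      (\<exists>t\<in>S. t \<subseteq> s - \<Union>(\<sigma> ` T) \<and> finite (s - (\<Union>(\<sigma> ` T) \<union> t)))"
    by (elim exE conjE)
  have c: "\<exists>t\<in>S. t \<subseteq> s - \<Union>(\<sigma> ` T) \<and> finite (s - (\<Union>(\<sigma> ` T) \<union> t))"
    if "s \<in> S" "finite T" "T \<subseteq> S" for s T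
    using c' that by simp
  have sing: "{a} \<in> S" for a using CI by (simp add: countably_intersected_def)
  have d: "countable {s \<inter> t | s. s \<in> S}" if "t \<in> S" for t
  proof -
    have "\<forall>s\<in>S. countable {s \<inter> t | t. t \<in> S}"
      using CI unfolding countably_intersected_def by (elim conjE)
    then have "countable {t \<inter> s | s. s \<in> S}" using that by (rule bspec)
    then show ?thesis by (simp only: Int_commute[of t])
  qed
  have le: "\<bar>set_sum (x n) s\<bar> \<le> B" if "s \<in> S" for n s
    using abs_set_sum_le_james[OF x that] B order_trans by blast
  have "0 \<le> B" using B james_norm_nonneg[OF x] order_trans by blast
  have split: "set_sum (x n) s = set_sum (x n) (s \<inter> U) + set_sum (x n) t + (\<Sum>a\<in>s - (U \<union> t). x n a)"
    if "t \<subseteq> s - U" "finite (s - (U \<union> t))" for n s t U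
  proof -
    have "s = (s \<inter> U \<union> t) \<union> (s - (U \<union> t))" using that by auto
    then have "set_sum (x n) s = set_sum (x n) (s \<inter> U \<union> t) + set_sum (x n) (s - (U \<union> t))"
      using set_sum_Un[OF x, of "s \<inter> U \<union> t" "s - (U \<union> t)" n] by auto
    also have "set_sum (x n) (s \<inter> U \<union> t) = set_sum (x n) (s \<inter> U) + set_sum (x n) t"
      using that by (intro set_sum_Un[OF x]) auto
    finally show ?thesis using that by (simp add: set_sum_finite)
  qed
  have xle: "\<bar>x n a\<bar> \<le> B" for n a
    using le[OF sing[of a], of n] by (simp add: set_sum_finite)
  \<comment> \<open>All \<open>x n\<close> vanish off \<open>D\<close>, so convergence at points
    concerns only countably many of them.\<close>
  define D where "D = (\<Union>n. {a. x n a \<noteq> 0})"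
  have "countable D"
    unfolding D_def using x by (intro countable_UN) (auto simp: fin_supp_def countable_finite)
  \<comment> \<open>\<open>P j\<close> collects what yields convergence on \<open>S\<close> up to an
    error \<open>1 / Suc j\<close>. The diagonal sequence over \<open>j\<close> is taken on top of
    the one used within each stage for the countably many traces and points.\<close>
  define P where "P j r \<longleftrightarrow> (\<forall>a. convergent (\<lambda>n. x (r n) a)) \<and> (\<exists>T. finite T \<and> T \<subseteq> S \<and>
      (\<forall>s\<in>S. convergent (\<lambda>n. set_sum (x (r n)) (s \<inter> \<Union>(\<sigma> ` T)))) \<and>
      (\<forall>t\<in>S. t \<inter> \<Union>(\<sigma> ` T) = {} \<longrightarrow> (\<forall>\<^sub>F n in sequentially. \<bar>set_sum (x (r n)) t\<bar> \<le> 1 / Suc j)))"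
    for j and r :: "nat \<Rightarrow> nat"
  interpret subseqs P
  proof
    fix j and q :: "nat \<Rightarrow> nat"
    obtain T r where T: "finite T" "T \<subseteq> S" and r: "strict_mono r"
      and small: "\<And>t. t \<in> S \<Longrightarrow> t \<inter> \<Union>(\<sigma> ` T) = {} \<Longrightarrow>
        \<forall>\<^sub>F n in sequentially. \<bar>set_sum (x (q (r n))) t\<bar> \<le> 1 / Suc j"
    proof (rule finite_family_small_off[of S \<sigma> "\<lambda>s n. set_sum (x (q n)) s" "B\<^sup>2" "1 / Suc j"])
      fix F n assume "finite F" "F \<subseteq> S" "disjoint F"
      then have "(\<Sum>s\<in>F. (set_sum (x (q n)) s)\<^sup>2) \<le> (james_norm S (x (q n)))\<^sup>2"
        by (rule sum_squares_le_james[OF x])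
      also have "\<dots> \<le> B\<^sup>2" by (intro power_mono B james_norm_nonneg x)
      finally show "(\<Sum>s\<in>F. (set_sum (x (q n)) s)\<^sup>2) \<le> B\<^sup>2" .
    qed (use \<sigma> in \<open>auto simp: set_sum_def\<close>)
    let ?U = "\<Union>(\<sigma> ` T)"
    let ?I = "{s \<inter> ?U | s. s \<in> S} \<union> (\<lambda>a. {a}) ` D"
    have "countable {s \<inter> ?U | s. s \<in> S}"
      using T \<sigma> d by (intro countable_Int_Union) auto
    then have I: "countable ?I" using \<open>countable D\<close> by simp
    have bnd: "bounded (range (\<lambda>n. set_sum (x (q (r n))) i))" if i: "i \<in> ?I" for i
    proof -
      have "\<exists>C. \<forall>n. \<bar>set_sum (x (q (r n))) i\<bar> \<le> C"
      proof (cases "i \<in> (\<lambda>a. {a}) ` D")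
        case True
        then show ?thesis using le sing by blast
      next
        case False
        then obtain s where s: "s \<in> S" "i = s \<inter> ?U" using i by auto
        obtain t where t: "t \<in> S" "t \<subseteq> s - ?U" "finite (s - (?U \<union> t))"
          using c[OF s(1) T] by blast
        let ?E = "s - (?U \<union> t)"
        \<comment> \<open>A trace need not belong to \<open>S\<close>, so \<open>B\<close> does not
          bound it directly. It is what remains of \<open>s\<close> after removing \<open>t\<close>
          and the finite rest, which accounts for the three terms.\<close>
        have "\<bar>set_sum (x n) i\<bar> \<le> B + B + card ?E * B" for n
        proof -
          have "\<bar>\<Sum>a\<in>?E. x n a\<bar> \<le> card ?E * B"
            using xle by (intro order_trans[OF sum_abs sum_bounded_above]) auto
          then show ?thesis
            using split[OF t(2,3), of n] le[OF s(1), of n] le[OF t(1), of n] unfolding s(2) by linarith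
        qed
        then show ?thesis by blast
      qed
      then show ?thesis by (auto simp: bounded_iff)
    qed
    obtain p :: "nat \<Rightarrow> nat" where p: "strict_mono p"
      and conv: "\<And>i. i \<in> ?I \<Longrightarrow> convergent ((\<lambda>n. set_sum (x (q (r n))) i) \<circ> p)"
      by (rule convergent_subseq_family[OF I, of "\<lambda>i n. set_sum (x (q (r n))) i"]) (use bnd in auto)
    have "convergent (\<lambda>n. x (q (r (p n))) a)" for a
    proof (cases "a \<in> D")
      case True
      then show ?thesis using conv[of "{a}"] by (simp add: comp_def set_sum_finite)
    next
      case False
      then have "x n a = 0" for n by (auto simp: D_def)
      then show ?thesis by (simp add: convergent_const)
    qed
    moreover have "convergent (\<lambda>n. set_sum (x (q (r (p n)))) (s \<inter> ?U))" if "s \<in> S" for s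
      using conv[of "s \<inter> ?U"] that by (auto simp: comp_def)
    moreover have "\<forall>\<^sub>F n in sequentially. \<bar>set_sum (x (q (r (p n)))) t\<bar> \<le> 1 / Suc j"
      if "t \<in> S" "t \<inter> ?U = {}" for t
      using eventually_subseq[OF p small[OF that]] .
    ultimately have "P j (q \<circ> (r \<circ> p))"
      unfolding P_def comp_def using T by (intro conjI allI exI[of _ T]) simp_all
    then show "\<exists>r'. strict_mono r' \<and> P j (q \<circ> r')"
      using strict_mono_o[OF r p] by blast
  qed
  \<comment> \<open>The diagonal argument requires that each \<open>P j\<close> passes to
    subsequences.\<close>
  have stable: "P j (s \<circ> r)" if r: "strict_mono r" and "P j s" for r s :: "nat \<Rightarrow> nat" and j
  proof -
    have conv: "convergent (\<lambda>n. v (r n))" if "convergent v" for v :: "nat \<Rightarrow> real"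
      using convergent_subseq_convergent[OF that r] by (simp add: comp_def)
    obtain T where T: "\<forall>a. convergent (\<lambda>n. x (s n) a)" "finite T" "T \<subseteq> S"
      "\<forall>u\<in>S. convergent (\<lambda>n. set_sum (x (s n)) (u \<inter> \<Union>(\<sigma> ` T)))"
      "\<forall>t\<in>S. t \<inter> \<Union>(\<sigma> ` T) = {} \<longrightarrow> (\<forall>\<^sub>F n in sequentially. \<bar>set_sum (x (s n)) t\<bar> \<le> 1 / Suc j)"
      using \<open>P j s\<close> unfolding P_def by (elim conjE exE)
    have "\<forall>\<^sub>F n in sequentially. \<bar>set_sum (x (s (r n))) t\<bar> \<le> 1 / Suc j"
      if "t \<in> S" "t \<inter> \<Union>(\<sigma> ` T) = {}" for t
      using eventually_subseq[OF r, of "\<lambda>n. \<bar>set_sum (x (s n)) t\<bar> \<le> 1 / Suc j"] T(5) that by blast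
    moreover have "\<forall>a. convergent (\<lambda>n. x (s (r n)) a)"
      using conv[OF T(1)[rule_format]] by blast
    moreover have "\<forall>u\<in>S. convergent (\<lambda>n. set_sum (x (s (r n))) (u \<inter> \<Union>(\<sigma> ` T)))"
      using conv[OF T(4)[rule_format]] by blast
    ultimately show ?thesis
      unfolding P_def comp_def using T(2,3) by (intro conjI exI[of _ T]) simp_all
  qed
  have "convergent (\<lambda>n. set_sum (x (diagseq n)) s)" if s: "s \<in> S" for s
  proof (rule convergent_if_eventually_close)
    fix \<epsilon> :: real assume "\<epsilon> > 0"
    then obtain j where j: "1 / real (Suc j) < \<epsilon>"
      using reals_Archimedean[of \<epsilon>] by (auto simp: field_simps)
    let ?r = "diagseq \<circ> ((+) (Suc j))"
    have Pj: "P j ?r" by (rule diagseq_holds[OF stable])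
    then obtain T where T: "finite T" "T \<subseteq> S"
      "convergent (\<lambda>n. set_sum (x (?r n)) (s \<inter> \<Union>(\<sigma> ` T)))"
      "\<forall>t\<in>S. t \<inter> \<Union>(\<sigma> ` T) = {} \<longrightarrow> (\<forall>\<^sub>F n in sequentially. \<bar>set_sum (x (?r n)) t\<bar> \<le> 1 / Suc j)"
      and sing_conv: "\<And>a. convergent (\<lambda>n. x (?r n) a)"
      using s unfolding P_def by (elim conjE exE) simp
    let ?U = "\<Union>(\<sigma> ` T)"
    obtain t where t: "t \<in> S" "t \<subseteq> s - ?U" "finite (s - (?U \<union> t))"
      using c[OF s T(1,2)] by blast
    \<comment> \<open>\<open>v\<close> drops from \<open>s\<close> the part \<open>t\<close> alone,
      so its distance to the sum over \<open>s\<close> is the sum over \<open>t\<close>, eventually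
      at most \<open>1 / Suc j\<close>.\<close>
    define v where "v n = set_sum (x (diagseq n)) (s \<inter> ?U) + (\<Sum>a\<in>s - (?U \<union> t). x (diagseq n) a)" for n
    have "convergent (\<lambda>n. v (n + Suc j))"
      unfolding v_def using T(3) sing_conv
      by (intro convergent_add convergent_sum) (simp_all add: add.commute)
    then have "convergent v" by (subst (asm) convergent_ignore_initial_segment)
    moreover have "\<forall>\<^sub>F n in sequentially. \<bar>set_sum (x (diagseq n)) s - v n\<bar> \<le> \<epsilon>"
    proof -
      have "\<forall>\<^sub>F n in sequentially. \<bar>set_sum (x (?r n)) t\<bar> \<le> 1 / Suc j"
        using bspec[OF T(4) t(1)] t(2) by auto
      then have "\<forall>\<^sub>F n in sequentially. \<bar>set_sum (x (diagseq (n + Suc j))) t\<bar> \<le> 1 / Suc j"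
        by (simp add: add.commute)
      then have "\<forall>\<^sub>F n in sequentially. \<bar>set_sum (x (diagseq n)) t\<bar> \<le> 1 / Suc j"
        by (subst (asm) eventually_sequentially_seg)
      then show ?thesis
        by eventually_elim (use split[OF t(2,3)] j in \<open>simp add: v_def\<close>)
    qed
    ultimately show "\<exists>v. convergent v \<and> (\<forall>\<^sub>F n in sequentially. \<bar>set_sum (x (diagseq n)) s - v n\<bar> \<le> \<epsilon>)"
      by blast
  qed
  then show ?thesis using that subseq_diagseq by blast
qed

section \<open>The Simons inequality\<close>

lemma summable_half_powers_scaleR:
  fixes g :: "nat \<Rightarrow> 'b::banach"
  assumes "\<And>k. norm (g k) \<le> B"
  shows "summable (\<lambda>k. (1/2) ^ Suc k *\<^sub>R g k)"
proof (rule summable_comparison_test')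
  show "summable (\<lambda>k. (1/2) ^ Suc k * B)"
    using power_half_series by (intro summable_mult2) (rule sums_summable)
  show "norm ((1/2) ^ k' *\<^sub>R g k) \<le> (1/2) ^ k' * B" for k k'
    using assms by (simp add: mult_left_mono)
qed

text \<open>The weights of a partial sum miss the mass \<open>(1/2) ^ N\<close>. Giving it to
  \<open>g N\<close> produces a true convex combination, and this correction tends to 0.\<close>

lemma suminf_half_powers_mem:
  fixes g :: "nat \<Rightarrow> 'b::banach"
  assumes C: "closed C" "convex C" and g: "\<And>k. g k \<in> C" and B: "\<And>k. norm (g k) \<le> B"
  shows "(\<Sum>k. (1/2) ^ Suc k *\<^sub>R g k) \<in> C"
proof -
  have geo: "(\<Sum>k<N. (1/2::real) ^ Suc k) = 1 - (1/2) ^ N" for N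
    by (induction N) simp_all
  have mem: "(\<Sum>k<N. (1/2) ^ Suc k *\<^sub>R g k) + (1/2) ^ N *\<^sub>R g N \<in> C" for N
  proof -
    define a where "a k = (if k < N then (1/2) ^ Suc k else (1/2) ^ N :: real)" for k
    have "sum a {..<Suc N} = 1" by (simp add: a_def geo[simplified])
    then have "(\<Sum>k<Suc N. a k *\<^sub>R g k) \<in> C"
      using C(2) g by (intro convex_sum) (auto simp: a_def)
    then show ?thesis by (simp add: a_def)
  qed
  have "(\<lambda>N. (1/2) ^ N *\<^sub>R g N) \<longlonglongrightarrow> 0"
  proof (rule Lim_null_comparison)
    show "(\<lambda>N. (1/2) ^ N * B) \<longlonglongrightarrow> 0"
      using tendsto_mult_right_zero[OF LIMSEQ_realpow_zero[of "1/2"], of B] by (simp add: mult.commute)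
    show "\<forall>\<^sub>F N in sequentially. norm ((1/2) ^ N *\<^sub>R g N) \<le> (1/2) ^ N * B"
      using B by (simp add: mult_left_mono)
  qed
  then have "(\<lambda>N. (\<Sum>k<N. (1/2) ^ Suc k *\<^sub>R g k) + (1/2) ^ N *\<^sub>R g N)
      \<longlonglongrightarrow> (\<Sum>k. (1/2) ^ Suc k *\<^sub>R g k) + 0"
    by (intro tendsto_add summable_LIMSEQ summable_half_powers_scaleR[OF B])
  then show ?thesis using closed_sequentially[OF C(1)] mem by (metis (no_types, lifting) add.right_neutral)
qed

text \<open>The \<open>g n\<close> are chosen greedily to minimise \<open>p (w n + g)\<close> up to a small error. At a functional
  that is maximal at \<open>v = h 0\<close>, this keeps \<open>w n\<close> below \<open>(2^n - 1) p v\<close>, so each tail average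
  \<open>h n = 2^n v - w n\<close> still has value about \<open>p v\<close>, although the \<open>y k\<close> tend to 0 there.\<close>

lemma simons_inequality:
  fixes y :: "nat \<Rightarrow> 'b::banach" and K :: "('b \<Rightarrow> real) set"
  assumes bl: "\<And>x. x \<in> K \<Longrightarrow> bounded_linear x"
    and att: "\<And>v. \<exists>x\<in>K. \<forall>z\<in>K. z v \<le> x v"
    and lim: "\<And>x. x \<in> K \<Longrightarrow> (\<lambda>k. x (y k)) \<longlonglongrightarrow> 0"
    and B: "\<And>k. norm (y k) \<le> B" and "\<epsilon> > 0"
  obtains v where "v \<in> closure (convex hull range y)" "\<And>x. x \<in> K \<Longrightarrow> x v \<le> \<epsilon>"
proof -
  define D where "D n = closure (convex hull (y ` {n..}))" for n
  have D: "closed (D n)" "convex (D n)" for n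
    by (simp_all add: D_def convex_convex_hull)
  have D_mem: "y k \<in> D n" if "n \<le> k" for n k
    unfolding D_def using that by (intro subsetD[OF closure_subset] hull_inc) simp
  have D_sub: "D n \<subseteq> C" if "closed C" "convex C" "\<And>k. k \<ge> n \<Longrightarrow> y k \<in> C" for n C
    unfolding D_def using that by (intro closure_minimal hull_minimal) auto
  have D_mono: "D n \<subseteq> D m" if "m \<le> n" for m n
    using that by (intro D_sub D D_mem) simp
  have DB: "norm g \<le> B" if "g \<in> D n" for g n
  proof -
    have "D n \<subseteq> cball 0 B" using B by (intro D_sub) auto
    then show ?thesis using that by auto
  qed
  obtain X where X: "\<And>v. X v \<in> K" "\<And>v z. z \<in> K \<Longrightarrow> z v \<le> X v v"
    using att by metis
  define p where "p v = X v v" for v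
  have p: "z v \<le> p v" if "z \<in> K" for z v
    using X(2)[OF that] by (simp add: p_def)
  have step: "\<exists>w'. w' - 2 *\<^sub>R w \<in> D n \<and> (\<forall>g\<in>D n. p (w' - w) \<le> p (w + g) + e)"
    if "e > 0" for w n and e :: real
  proof -
    let ?A = "(\<lambda>g. p (w + g)) ` D n"
    \<comment> \<open>Any single functional of the family is bounded on the bounded set
      \<open>w + D n\<close> and lies below \<open>p\<close>, so the infimum of \<open>?A\<close> is
      finite. Here \<open>K\<close> is a bound for that functional.\<close>
    obtain K where K: "\<And>v. norm (X 0 v) \<le> norm v * K" "0 \<le> K"
      using bounded_linear.nonneg_bounded[OF bl[OF X(1)[of 0]]] by blast
    have "- ((norm w + B) * K) \<le> p (w + g)" if "g \<in> D n" for g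
    proof -
      have "norm (X 0 (w + g)) \<le> (norm w + B) * K"
        using K(1)[of "w + g"] norm_triangle_ineq[of w g] DB[OF that] K(2)
        by (smt (verit) mult_right_mono)
      then show ?thesis using p[OF X(1)[of 0], of "w + g"] by auto
    qed
    then have bdd: "bdd_below ?A" by (intro bdd_belowI2)
    have "?A \<noteq> {}" using D_mem[of n n] by auto
    then obtain g where g: "g \<in> D n" "p (w + g) < Inf ?A + e"
      using cInf_lessD[of ?A "Inf ?A + e"] \<open>e > 0\<close> by auto
    have "p (w + g) \<le> p (w + h) + e" if "h \<in> D n" for h
      using g(2) cINF_lower[OF bdd that] by linarith
    then show ?thesis
      using g(1) by (intro exI[of _ "2 *\<^sub>R w + g"]) (simp add: scaleR_2 algebra_simps)
  qed
  \<comment> \<open>The errors \<open>\<epsilon> / 2 ^ Suc (Suc n)\<close> add up to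
    \<open>\<epsilon> / 2\<close> over all \<open>n\<close>, leaving the other half for the limit of
    the \<open>y k\<close>.\<close>
  have "\<exists>w. \<forall>n. (n = 0 \<longrightarrow> w n = 0) \<and> w (Suc n) - 2 *\<^sub>R w n \<in> D n \<and>
      (\<forall>g\<in>D n. p (w (Suc n) - w n) \<le> p (w n + g) + \<epsilon> / 2 ^ Suc (Suc n))"
    by (rule dependent_nat_choice) (use step \<open>\<epsilon> > 0\<close> in auto)
  then obtain w where w0: "w 0 = 0" and wD: "\<And>n. w (Suc n) - 2 *\<^sub>R w n \<in> D n"
    and wp: "\<And>n g. g \<in> D n \<Longrightarrow> p (w (Suc n) - w n) \<le> p (w n + g) + \<epsilon> / 2 ^ Suc (Suc n)"
    by metis
  define g where "g n = w (Suc n) - 2 *\<^sub>R w n" for n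
  define h where "h n = (\<Sum>k. (1/2) ^ Suc k *\<^sub>R g (n + k))" for n
  have gD: "g k \<in> D n" if "n \<le> k" for n k
    using wD[of k] D_mono[OF that] by (auto simp: g_def)
  have gB: "norm (g n) \<le> B" for n using DB[OF gD[of n n]] by simp
  have hD: "h n \<in> D n" for n
    unfolding h_def using gD gB by (intro suminf_half_powers_mem D) auto
  have h_rec: "h n = (1/2) *\<^sub>R (g n + h (Suc n))" for n
  proof -
    have "h n = (\<Sum>k. (1/2) ^ Suc (Suc k) *\<^sub>R g (n + Suc k)) + (1/2) *\<^sub>R g n"
      unfolding h_def
      using suminf_split_head[OF summable_half_powers_scaleR[of "\<lambda>k. g (n + k)" B]] gB by simp
    also have "(\<Sum>k. (1/2) ^ Suc (Suc k) *\<^sub>R g (n + Suc k)) = (1/2) *\<^sub>R h (Suc n)"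
      unfolding h_def
      using suminf_scaleR_right[OF summable_half_powers_scaleR[of "\<lambda>k. g (Suc n + k)" B], of "1/2"] gB
      by simp
    finally show ?thesis by (simp add: scaleR_add_right)
  qed
  let ?v = "h 0"
  \<comment> \<open>Scaling the series for \<open>h 0\<close> by \<open>2 ^ n\<close> turns its
    first \<open>n\<close> terms into \<open>w n\<close> and its tail into
    \<open>h n\<close>.\<close>
  have v: "2 ^ n *\<^sub>R ?v = w n + h n" for n
  proof (induction n)
    case (Suc n)
    have "2 ^ Suc n *\<^sub>R ?v = 2 *\<^sub>R (w n + h n)" by (simp flip: Suc)
    also have "\<dots> = w (Suc n) + h (Suc n)"
      by (subst h_rec) (simp add: g_def scaleR_add_right)
    finally show ?case .
  qed (simp add: w0)
  let ?x = "X ?v"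
  interpret x: bounded_linear ?x using bl X(1) .
  have pv: "p (2 ^ n *\<^sub>R ?v) \<le> 2 ^ n * p ?v" for n
  proof -
    interpret y: bounded_linear "X (2 ^ n *\<^sub>R ?v)" using bl X(1) .
    show ?thesis using p[OF X(1)] by (simp add: p_def[of "2 ^ n *\<^sub>R ?v"] y.scaleR)
  qed
  \<comment> \<open>The tail \<open>h n\<close> itself competes in the minimisation over
    \<open>D n\<close>, and \<open>w n + h n\<close> is \<open>2 ^ n *\<^sub>R ?v\<close>. Each
    increment of \<open>w\<close> thus costs at most \<open>2 ^ n * p ?v\<close> plus the error, and
    the powers sum to \<open>2 ^ n - 1\<close>.\<close>
  have xw: "?x (w n) \<le> (2 ^ n - 1) * p ?v + \<epsilon> / 2 * (1 - 1 / 2 ^ n)" for n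
  proof (induction n)
    case (Suc n)
    have "?x (w (Suc n)) = ?x (w n) + ?x (w (Suc n) - w n)" by (simp add: x.diff)
    also have "?x (w (Suc n) - w n) \<le> p (w (Suc n) - w n)" by (rule p[OF X(1)])
    also have "\<dots> \<le> p (w n + h n) + \<epsilon> / 2 ^ Suc (Suc n)" by (rule wp[OF hD])
    also have "\<dots> \<le> 2 ^ n * p ?v + \<epsilon> / 2 ^ Suc (Suc n)" using pv[of n] by (simp add: v)
    finally show ?case using Suc by (simp add: field_simps)
  qed (simp add: w0 x.zero)
  have xh: "p ?v - \<epsilon> / 2 \<le> ?x (h n)" for n
  proof -
    have "2 ^ n * p ?v = ?x (w n) + ?x (h n)"
      using arg_cong[OF v[of n], of ?x] by (simp add: p_def x.add x.scaleR)
    moreover have "\<epsilon> / 2 * (1 - 1 / 2 ^ n) \<le> \<epsilon> / 2"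
      using \<open>\<epsilon> > 0\<close> by (simp add: field_simps)
    ultimately show ?thesis using xw[of n] by (simp add: algebra_simps)
  qed
  obtain n where n: "\<And>k. k \<ge> n \<Longrightarrow> ?x (y k) \<le> \<epsilon> / 2"
  proof -
    have "\<forall>\<^sub>F k in sequentially. ?x (y k) < \<epsilon> / 2"
      using order_tendstoD(2)[OF lim[OF X(1)], of "\<epsilon> / 2"] \<open>\<epsilon> > 0\<close> by simp
    then show ?thesis using that unfolding eventually_sequentially by (meson less_imp_le)
  qed
  \<comment> \<open>A closed half-space containing all late \<open>y k\<close> contains the whole
    tail hull, in particular \<open>h n\<close>; the lower bound \<open>xh\<close> then forces
    \<open>p ?v\<close> below \<open>\<epsilon>\<close>.\<close>
  have "D n \<subseteq> {u. ?x u \<le> \<epsilon> / 2}"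
  proof (rule D_sub)
    show "closed {u. ?x u \<le> \<epsilon> / 2}"
      by (intro closed_Collect_le continuous_intros linear_continuous_on bl X(1))
    show "convex {u. ?x u \<le> \<epsilon> / 2}"
    proof (rule convexI)
      fix u u' and a b :: real
      assume "u \<in> {u. ?x u \<le> \<epsilon> / 2}" "u' \<in> {u. ?x u \<le> \<epsilon> / 2}" "0 \<le> a" "0 \<le> b" "a + b = 1"
      then show "a *\<^sub>R u + b *\<^sub>R u' \<in> {u. ?x u \<le> \<epsilon> / 2}"
        using convex_bound_le[of "?x u" "\<epsilon> / 2" "?x u'" a b]
        by (simp only: mem_Collect_eq x.add x.scaleR real_scaleR_def)
    qed
  qed (use n in auto)
  then have "p ?v \<le> \<epsilon>" using xh[of n] hD[of n] by force
  then have "x ?v \<le> \<epsilon>" if "x \<in> K" for x using p[OF that, of ?v] by linarith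
  moreover have "?v \<in> closure (convex hull range y)" using hD[of 0] by (simp add: D_def atLeast_0)
  ultimately show ?thesis using that by blast
qed

section \<open>Functionals on the completion\<close>

text \<open>On \<open>V\<close> the map is 1-Lipschitz, so it extends by uniform continuity;
  linearity and the norm bound pass to limits of sequences in \<open>V\<close>.\<close>

lemma dense_subspace_extension:
  fixes V :: "'b::real_normed_vector set" and f :: "'b \<Rightarrow> real"
  assumes V: "subspace V" "closure V = UNIV"
    and add: "\<And>u v. u \<in> V \<Longrightarrow> v \<in> V \<Longrightarrow> f (u + v) = f u + f v"
    and scale: "\<And>r v. v \<in> V \<Longrightarrow> f (r *\<^sub>R v) = r * f v"
    and le: "\<And>v. v \<in> V \<Longrightarrow> \<bar>f v\<bar> \<le> norm v"
  obtains e where "bounded_linear e" "\<And>v. v \<in> V \<Longrightarrow> e v = f v" "\<And>v. \<bar>e v\<bar> \<le> norm v"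
proof -
  have "uniformly_continuous_on V f"
    unfolding uniformly_continuous_on_def
  proof (intro allI impI)
    fix d :: real assume "d > 0"
    have "dist (f u) (f v) \<le> dist u v" if "u \<in> V" "v \<in> V" for u v
    proof -
      have "f (u - v) = f u - f v"
        using add[OF that(1) subspace_scale[OF V(1) that(2), of "-1"]] scale[OF that(2), of "-1"] by simp
      then show ?thesis
        using le[OF subspace_diff[OF V(1) that]] by (simp add: dist_norm)
    qed
    then show "\<exists>d'>0. \<forall>u\<in>V. \<forall>v\<in>V. dist v u < d' \<longrightarrow> dist (f v) (f u) < d"
      using \<open>d > 0\<close> by (intro exI[of _ d]) (auto intro: le_less_trans)
  qed
  then obtain e where e: "uniformly_continuous_on (closure V) e" "\<And>v. v \<in> V \<Longrightarrow> f v = e v"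
    using uniformly_continuous_on_extension_on_closure by metis
  have cont: "continuous_on UNIV e"
    using uniformly_continuous_imp_continuous[OF e(1)] V(2) by simp
  have lim: "(\<lambda>n. e (w n)) \<longlonglongrightarrow> e l" if "w \<longlonglongrightarrow> l" for w :: "nat \<Rightarrow> 'b" and l
    using continuous_on_tendsto_compose[OF cont that] by simp
  have approx: "\<exists>w. (\<forall>n. w n \<in> V) \<and> w \<longlonglongrightarrow> v" for v
    using V(2) by (metis UNIV_I closure_sequential)
  have e_add: "e (u + v) = e u + e v" for u v
  proof -
    obtain a b where ab: "\<And>n. a n \<in> V" "a \<longlonglongrightarrow> u" "\<And>n. b n \<in> V" "b \<longlonglongrightarrow> v"
      using approx by metis
    have "e (a n + b n) = e (a n) + e (b n)" for n
      using ab e(2) add subspace_add[OF V(1)] by metis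
    then have "(\<lambda>n. e (a n + b n)) \<longlonglongrightarrow> e u + e v"
      using tendsto_add[OF lim[OF ab(2)] lim[OF ab(4)]] by simp
    then show ?thesis using lim[OF tendsto_add[OF ab(2,4)]] LIMSEQ_unique by blast
  qed
  have e_scale: "e (r *\<^sub>R v) = r * e v" for r v
  proof -
    obtain a where a: "\<And>n. a n \<in> V" "a \<longlonglongrightarrow> v" using approx by metis
    have "e (r *\<^sub>R a n) = r * e (a n)" for n
      using a e(2) scale subspace_scale[OF V(1)] by metis
    then have "(\<lambda>n. e (r *\<^sub>R a n)) \<longlonglongrightarrow> r * e v"
      using tendsto_mult_left[OF lim[OF a(2)], of r] by simp
    then show ?thesis
      using lim[OF tendsto_scaleR[OF tendsto_const a(2)]] LIMSEQ_unique by blast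
  qed
  have e_le: "\<bar>e v\<bar> \<le> norm v" for v
  proof -
    obtain a where a: "\<And>n. a n \<in> V" "a \<longlonglongrightarrow> v" using approx by metis
    have "\<bar>e (a n)\<bar> \<le> norm (a n)" for n using le[OF a(1)] e(2)[OF a(1)] by simp
    then show ?thesis
      by (intro LIMSEQ_le[OF tendsto_rabs[OF lim[OF a(2)]] tendsto_norm[OF a(2)]]) auto
  qed
  have "bounded_linear e"
    using e_add e_scale e_le by (intro bounded_linear_intro[of e 1]) auto
  then show ?thesis using that e(2) e_le by simp
qed

text \<open>A closed subset of the cube of 0-1 functions, which is compact by Tychonoff.\<close>

lemma compact_indicators:
  assumes "countably_intersected S"
  shows "compact ((\<lambda>s. indicator s :: 'a \<Rightarrow> real) ` S)"
proof -
  let ?P = "PiE UNIV (\<lambda>_. {0, 1}) :: ('a \<Rightarrow> real) set"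
  have "compactin (product_topology (\<lambda>_. euclidean) UNIV) ?P"
    by (subst compactin_PiE) auto
  then have "compact ?P"
    by (simp only: euclidean_product_topology compactin_euclidean_iff)
  moreover have "closed ((\<lambda>s. indicator s :: 'a \<Rightarrow> real) ` S)"
    using assms unfolding countably_intersected_def by (elim conjE)
  ultimately have "compact (?P \<inter> (\<lambda>s. indicator s) ` S)" by (rule compact_Int_closed)
  moreover have "(\<lambda>s. indicator s) ` S \<subseteq> ?P" by (auto simp: indicator_def)
  ultimately show ?thesis by (simp add: inf.absorb2)
qed

text \<open>For fixed \<open>\<phi>\<close> this writes the sum over \<open>s\<close> as a finite
  linear combination of coordinates of the indicator, hence as a function continuous in the product
  topology.\<close>

lemma sum_indicator_eq_set_sum:
  "\<phi> \<in> fin_supp \<Longrightarrow> (\<Sum>a\<in>{a. \<phi> a \<noteq> 0}. \<phi> a * indicator s a) = set_sum \<phi> s"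
  by (simp add: set_sum_def fin_supp_def sum.inter_restrict[symmetric] indicator_def if_distrib
      sum.If_cases Int_commute Collect_conj_eq cong: if_cong)

locale james_completion =
  fixes S :: "'a set set" and T :: "('a \<Rightarrow> real) \<Rightarrow> 'b::banach"
  assumes CI: "countably_intersected S" and completion: "is_james_completion S T"
begin

lemma T_add: "\<phi> \<in> fin_supp \<Longrightarrow> \<psi> \<in> fin_supp \<Longrightarrow> T (\<lambda>a. \<phi> a + \<psi> a) = T \<phi> + T \<psi>"
  and T_scale: "\<phi> \<in> fin_supp \<Longrightarrow> T (\<lambda>a. r * \<phi> a) = r *\<^sub>R T \<phi>"
  and norm_T: "\<phi> \<in> fin_supp \<Longrightarrow> norm (T \<phi>) = james_norm S \<phi>"
  and dense: "closure (T ` fin_supp) = UNIV"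
  using completion unfolding is_james_completion_def by blast+

lemma T_diff: "\<phi> \<in> fin_supp \<Longrightarrow> \<psi> \<in> fin_supp \<Longrightarrow> T (\<lambda>a. \<phi> a - \<psi> a) = T \<phi> - T \<psi>"
  using T_add[of \<phi> "\<lambda>a. -1 * \<psi> a"] T_scale[of \<psi> "-1"] fin_supp_scale[of \<psi> "-1"] by simp

lemma S_nonempty: "S \<noteq> {}"
  using CI by (auto simp: countably_intersected_def)

lemma subspace_range: "subspace (T ` fin_supp)"
proof (rule subspaceI)
  have "T (\<lambda>a. 0) = 0" using T_scale[of "\<lambda>a. 0" 0] by (simp add: fin_supp_def)
  then show "0 \<in> T ` fin_supp" by (intro image_eqI[where x = "\<lambda>a. 0"]) (auto simp: fin_supp_def)
  show "u + v \<in> T ` fin_supp" if uv: "u \<in> T ` fin_supp" "v \<in> T ` fin_supp" for u v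
  proof -
    obtain \<phi> \<psi> where "\<phi> \<in> fin_supp" "u = T \<phi>" "\<psi> \<in> fin_supp" "v = T \<psi>" using uv by blast
    then show ?thesis
      using imageI[OF fin_supp_add[of \<phi> \<psi>], of T] T_add[of \<phi> \<psi>] by simp
  qed
  show "r *\<^sub>R u \<in> T ` fin_supp" if u: "u \<in> T ` fin_supp" for r u
  proof -
    obtain \<phi> where "\<phi> \<in> fin_supp" "u = T \<phi>" using u by blast
    then show ?thesis
      using imageI[OF fin_supp_scale[of \<phi> r], of T] T_scale[of \<phi> r] by simp
  qed
qed

lemma ex_functional:
  assumes s: "s \<in> S"
  shows "\<exists>e. bounded_linear e \<and> (\<forall>\<phi>\<in>fin_supp. e (T \<phi>) = set_sum \<phi> s) \<and> (\<forall>v. \<bar>e v\<bar> \<le> norm v)"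
proof -
  \<comment> \<open>The value does not depend on the chosen preimage: two preimages of a vector
    differ by a function of James norm 0, whose sum over \<open>s\<close> vanishes.\<close>
  define f where "f v = set_sum (SOME \<phi>. \<phi> \<in> fin_supp \<and> T \<phi> = v) s" for v
  have f: "f (T \<phi>) = set_sum \<phi> s" if \<phi>: "\<phi> \<in> fin_supp" for \<phi>
  proof -
    define \<psi> where "\<psi> = (SOME \<psi>. \<psi> \<in> fin_supp \<and> T \<psi> = T \<phi>)"
    have \<psi>: "\<psi> \<in> fin_supp" "T \<psi> = T \<phi>"
      unfolding \<psi>_def using \<phi> by (metis (mono_tags, lifting) someI)+
    have "\<bar>set_sum (\<lambda>a. \<psi> a - \<phi> a) s\<bar> \<le> norm (T (\<lambda>a. \<psi> a - \<phi> a))"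
      using abs_set_sum_le_james[OF fin_supp_diff[OF \<psi>(1) \<phi>] s] norm_T[OF fin_supp_diff[OF \<psi>(1) \<phi>]] by simp
    then have "set_sum \<psi> s = set_sum \<phi> s"
      using T_diff[OF \<psi>(1) \<phi>] set_sum_diff[OF \<psi>(1) \<phi>, of s] \<psi>(2) by simp
    then show ?thesis by (simp add: f_def \<psi>_def)
  qed
  obtain e where e: "bounded_linear e" "\<And>v. v \<in> T ` fin_supp \<Longrightarrow> e v = f v" "\<And>v. \<bar>e v\<bar> \<le> norm v"
  proof (rule dense_subspace_extension[OF subspace_range dense, of f])
    show "f (u + v) = f u + f v" if uv: "u \<in> T ` fin_supp" "v \<in> T ` fin_supp" for u v
    proof -
      obtain \<phi> \<psi> where *: "\<phi> \<in> fin_supp" "u = T \<phi>" "\<psi> \<in> fin_supp" "v = T \<psi>" using uv by blast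
      then have "f (T (\<lambda>a. \<phi> a + \<psi> a)) = f u + f v"
        by (simp add: f fin_supp_add set_sum_add)
      then show ?thesis using T_add[OF *(1,3)] * by simp
    qed
    show "f (r *\<^sub>R u) = r * f u" if u: "u \<in> T ` fin_supp" for r u
    proof -
      obtain \<phi> where *: "\<phi> \<in> fin_supp" "u = T \<phi>" using u by blast
      then have "f (T (\<lambda>a. r * \<phi> a)) = r * f u"
        by (simp add: f fin_supp_scale set_sum_scale)
      then show ?thesis using T_scale[OF *(1)] * by simp
    qed
    show "\<bar>f u\<bar> \<le> norm u" if u: "u \<in> T ` fin_supp" for u
    proof -
      obtain \<phi> where *: "\<phi> \<in> fin_supp" "u = T \<phi>" using u by blast
      then show ?thesis using abs_set_sum_le_james[OF *(1) s] by (simp add: f norm_T)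
    qed
  qed blast
  show ?thesis using e f by (intro exI[of _ e]) auto
qed

text \<open>The functional \<open>s\<^sup>*\<close>: for a member of \<open>S\<close>, the unique
  continuous extension to the completion of summation over \<open>s\<close>.\<close>

definition sum_functional :: "'a set \<Rightarrow> 'b \<Rightarrow> real" where
  "sum_functional s = (SOME e. bounded_linear e \<and> (\<forall>\<phi>\<in>fin_supp. e (T \<phi>) = set_sum \<phi> s) \<and> (\<forall>v. \<bar>e v\<bar> \<le> norm v))"

lemma sum_functional:
  assumes "s \<in> S"
  shows bounded_linear_sum_functional: "bounded_linear (sum_functional s)"
    and sum_functional_T: "\<phi> \<in> fin_supp \<Longrightarrow> sum_functional s (T \<phi>) = set_sum \<phi> s"
    and abs_sum_functional_le: "\<bar>sum_functional s v\<bar> \<le> norm v"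
  using someI_ex[OF ex_functional[OF assms], folded sum_functional_def] by blast+

text \<open>On the compact space of indicators of members of \<open>S\<close>, the map \<open>s \<mapsto> s\<^sup>*(v)\<close> is a uniform
  limit of the continuous maps that come from finitely supported functions.\<close>

lemma sum_functional_attains_sup:
  obtains s where "s \<in> S" "\<And>t. t \<in> S \<Longrightarrow> \<bar>sum_functional t v\<bar> \<le> \<bar>sum_functional s v\<bar>"
proof -
  let ?K = "(\<lambda>s. indicator s :: 'a \<Rightarrow> real) ` S"
  \<comment> \<open>Continuity needs a map on functions rather than on sets; the set where
    \<open>\<kappa>\<close> equals 1 recovers \<open>s\<close> from its indicator.\<close>
  define E where "E \<kappa> = sum_functional {a. \<kappa> a = 1} v" for \<kappa> :: "'a \<Rightarrow> real"
  have E: "E (indicator s) = sum_functional s v" for s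
  proof -
    have "{a. indicator s a = (1::real)} = s" by (auto simp: indicator_def)
    then show ?thesis by (simp add: E_def)
  qed
  obtain w where w: "\<And>n. w n \<in> T ` fin_supp" "w \<longlonglongrightarrow> v"
    using dense by (metis UNIV_I closure_sequential)
  have "\<exists>\<phi>. \<forall>n. \<phi> n \<in> fin_supp \<and> w n = T (\<phi> n)"
    using w(1) by (intro choice allI) (simp add: image_iff Bex_def)
  then obtain \<phi> where \<phi>: "\<And>n. \<phi> n \<in> fin_supp" "\<And>n. w n = T (\<phi> n)"
    by auto
  have "continuous_on ?K E"
  proof (rule uniform_limit_theorem)
    show "\<forall>\<^sub>F n in sequentially. continuous_on ?K (\<lambda>\<kappa>. \<Sum>a\<in>{a. \<phi> n a \<noteq> 0}. \<phi> n a * \<kappa> a)"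
      by (intro always_eventually allI continuous_intros continuous_on_product_then_coordinatewise
          continuous_on_id)
    show "uniform_limit ?K (\<lambda>n \<kappa>. \<Sum>a\<in>{a. \<phi> n a \<noteq> 0}. \<phi> n a * \<kappa> a) E sequentially"
    proof (rule uniform_limitI)
      fix e :: real assume "e > 0"
      then have "\<forall>\<^sub>F n in sequentially. dist (w n) v < e" by (rule tendstoD[OF w(2)])
      then show "\<forall>\<^sub>F n in sequentially. \<forall>\<kappa>\<in>?K. dist (\<Sum>a\<in>{a. \<phi> n a \<noteq> 0}. \<phi> n a * \<kappa> a) (E \<kappa>) < e"
      proof eventually_elim
        case (elim n)
        show ?case
        proof
          fix \<kappa> assume "\<kappa> \<in> ?K"
          then obtain s where s: "s \<in> S" "\<kappa> = indicator s" by blast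
          interpret bounded_linear "sum_functional s" by (rule bounded_linear_sum_functional[OF s(1)])
          \<comment> \<open>The norm bound 1 holds for every \<open>s\<close> at once, which makes
            the approximation uniform.\<close>
          have "\<bar>sum_functional s (w n - v)\<bar> < e"
            using abs_sum_functional_le[OF s(1), of "w n - v"] elim by (simp add: dist_norm)
          then show "dist (\<Sum>a\<in>{a. \<phi> n a \<noteq> 0}. \<phi> n a * \<kappa> a) (E \<kappa>) < e"
            using sum_functional_T[OF s(1) \<phi>(1)[of n]]
            by (simp add: s(2) E sum_indicator_eq_set_sum[OF \<phi>(1)] dist_real_def diff \<phi>(2))
        qed
      qed
    qed
  qed simp
  then have "continuous_on ?K (\<lambda>\<kappa>. \<bar>E \<kappa>\<bar>)" by (rule continuous_on_rabs)
  then obtain \<kappa> where "\<kappa> \<in> ?K" "\<And>\<kappa>'. \<kappa>' \<in> ?K \<Longrightarrow> \<bar>E \<kappa>'\<bar> \<le> \<bar>E \<kappa>\<bar>"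
    using continuous_attains_sup[OF compact_indicators[OF CI]] S_nonempty by blast
  then obtain s where "s \<in> S" "\<And>t. t \<in> S \<Longrightarrow> \<bar>E (indicator t)\<bar> \<le> \<bar>E (indicator s)\<bar>" by blast
  then show ?thesis using that by (simp add: E)
qed

section \<open>Convex combinations that are small on \<open>S\<close>, and then small in
  norm\<close>

lemma convex_combination_small:
  assumes x: "\<And>k. x k \<in> fin_supp" and B: "\<And>k. norm (T (x k)) \<le> B"
    and lim: "\<And>s. s \<in> S \<Longrightarrow> (\<lambda>k. set_sum (x k) s) \<longlonglongrightarrow> 0" and "\<epsilon> > 0"
  obtains z where "z \<in> fin_supp" "T z \<in> convex hull range (\<lambda>k. T (x k))"
    "\<And>s. s \<in> S \<Longrightarrow> \<bar>set_sum z s\<bar> \<le> \<epsilon>"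
proof -
  let ?y = "\<lambda>k. T (x k)"
  \<comment> \<open>The inequality of Simons bounds functionals from above only; adding the
    negatives turns this into a bound on absolute values.\<close>
  let ?K = "sum_functional ` S \<union> (\<lambda>s v. - sum_functional s v) ` S"
  obtain v where v: "v \<in> closure (convex hull range ?y)" "\<And>e. e \<in> ?K \<Longrightarrow> e v \<le> \<epsilon> / 2"
  proof (rule simons_inequality[of ?K ?y B "\<epsilon> / 2"])
    show "bounded_linear e" if "e \<in> ?K" for e
      using that bounded_linear_sum_functional by (auto intro: bounded_linear_minus)
    show "\<exists>e\<in>?K. \<forall>e'\<in>?K. e' v \<le> e v" for v
    proof -
      obtain s where s: "s \<in> S" "\<And>t. t \<in> S \<Longrightarrow> \<bar>sum_functional t v\<bar> \<le> \<bar>sum_functional s v\<bar>"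
        using sum_functional_attains_sup[of v] by auto
      have *: "\<forall>e'\<in>?K. e' v \<le> \<bar>sum_functional s v\<bar>"
        using s(2) by (auto simp: abs_le_iff)
      show ?thesis
      proof (cases "sum_functional s v \<ge> 0")
        case True
        then show ?thesis using * s(1) by (intro bexI[of _ "sum_functional s"]) auto
      next
        case False
        then show ?thesis using * s(1) by (intro bexI[of _ "\<lambda>v. - sum_functional s v"]) auto
      qed
    qed
    show "(\<lambda>k. e (?y k)) \<longlonglongrightarrow> 0" if e: "e \<in> ?K" for e
    proof -
      obtain s where s: "s \<in> S" "e = sum_functional s \<or> e = (\<lambda>v. - sum_functional s v)" using e by blast
      then show ?thesis
        using lim[OF s(1)] tendsto_minus[OF lim[OF s(1)]] sum_functional_T[OF s(1) x] by auto
    qed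
  qed (use B \<open>\<epsilon> > 0\<close> in auto)
  \<comment> \<open>The vector \<open>v\<close> lies only in the closed hull and need not come from
    a finitely supported function. A point of the hull itself does, at the price of the second
    \<open>\<epsilon> / 2\<close>.\<close>
  obtain u where u: "u \<in> convex hull range ?y" "dist u v < \<epsilon> / 2"
    using v(1) \<open>\<epsilon> > 0\<close> unfolding closure_approachable by (meson half_gt_zero)
  have "convex hull range ?y \<subseteq> T ` fin_supp"
    using x by (intro hull_minimal subspace_imp_convex subspace_range) auto
  then obtain z where z: "z \<in> fin_supp" "u = T z" using u(1) by blast
  have "\<bar>set_sum z s\<bar> \<le> \<epsilon>" if s: "s \<in> S" for s
  proof -
    interpret bounded_linear "sum_functional s" by (rule bounded_linear_sum_functional[OF s])
    have "sum_functional s v \<le> \<epsilon> / 2" "- sum_functional s v \<le> \<epsilon> / 2"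
      using v(2)[of "sum_functional s"] v(2)[of "\<lambda>v. - sum_functional s v"] s by auto
    moreover have "\<bar>sum_functional s (u - v)\<bar> < \<epsilon> / 2"
      using abs_sum_functional_le[OF s, of "u - v"] u(2) by (simp add: dist_norm)
    ultimately show ?thesis
      using sum_functional_T[OF s z(1)] unfolding diff z(2) by linarith
  qed
  then show ?thesis using that z u(1) by simp
qed

text \<open>If all convex combinations had norm at least \<open>c\<close>, a sum of \<open>n\<close>
  of them would have norm at least \<open>c * n\<close>; blocks with small mixed terms give a sum of
  norm only of order \<open>sqrt n\<close>.\<close>

lemma convex_hull_not_bounded_away:
  assumes x: "\<And>k. x k \<in> fin_supp" and B: "\<And>k. norm (T (x k)) \<le> B"
    and lim: "\<And>s. s \<in> S \<Longrightarrow> (\<lambda>k. set_sum (x k) s) \<longlonglongrightarrow> 0" and "c > 0"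
  shows "\<exists>v \<in> convex hull range (\<lambda>k. T (x k)). norm v < c"
proof (rule ccontr)
  let ?C = "convex hull range (\<lambda>k. T (x k))"
  assume "\<not> ?thesis"
  then have c: "c \<le> norm v" if "v \<in> ?C" for v using that by force
  have CB: "norm v \<le> B" if "v \<in> ?C" for v
  proof -
    have "?C \<subseteq> cball 0 B" using B by (intro hull_minimal) auto
    then show ?thesis using that by auto
  qed
  have "\<exists>w \<in> fin_supp. (james_norm S w)\<^sup>2 \<le> real (Suc n) * (B\<^sup>2 + 1) \<and> (1 / real (Suc n)) *\<^sub>R T w \<in> ?C" for n
  proof (induction n)
    case 0
    have "T (x 0) \<in> ?C" by (intro hull_inc) auto
    moreover have "(james_norm S (x 0))\<^sup>2 \<le> B\<^sup>2"
      using B[of 0] by (intro power_mono james_norm_nonneg x) (simp add: norm_T x)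
    ultimately show ?case using x[of 0] by (intro bexI[of _ "x 0"]) auto
  next
    case (Suc n)
    then obtain w where w: "w \<in> fin_supp" "(james_norm S w)\<^sup>2 \<le> real (Suc n) * (B\<^sup>2 + 1)"
      "(1 / real (Suc n)) *\<^sub>R T w \<in> ?C" by blast
    \<comment> \<open>\<open>m * \<delta>\<close> is the mixed term in
      \<open>james_norm_square_add_le\<close>. This \<open>\<delta>\<close> keeps it at most 1,
      whence the summand 1 in \<open>B\<^sup>2 + 1\<close>; the 1 in the denominator covers
      \<open>m = 0\<close>.\<close>
    define m where "m = 2 * card {a. w a \<noteq> 0} * james_norm S w"
    define \<delta> where "\<delta> = 1 / (m + 1)"
    have m: "0 \<le> m" using james_norm_nonneg[OF w(1)] by (simp add: m_def)
    then have "\<delta> > 0" by (simp add: \<delta>_def)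
    obtain z where z: "z \<in> fin_supp" "T z \<in> ?C" "\<And>s. s \<in> S \<Longrightarrow> \<bar>set_sum z s\<bar> \<le> \<delta>"
      using convex_combination_small[OF x B lim \<open>\<delta> > 0\<close>] by blast
    have "(james_norm S z)\<^sup>2 \<le> B\<^sup>2"
      using CB[OF z(2)] by (intro power_mono james_norm_nonneg z(1)) (simp add: norm_T z(1))
    moreover have "m * \<delta> \<le> 1" using m by (simp add: \<delta>_def)
    moreover have "(james_norm S (\<lambda>a. w a + z a))\<^sup>2 \<le> (james_norm S w)\<^sup>2 + (james_norm S z)\<^sup>2 + m * \<delta>"
      using james_norm_square_add_le[OF w(1) z(1) less_imp_le[OF \<open>\<delta> > 0\<close>] z(3)] by (simp add: m_def mult.assoc)
    ultimately have "(james_norm S (\<lambda>a. w a + z a))\<^sup>2 \<le> real (Suc n) * (B\<^sup>2 + 1) + (B\<^sup>2 + 1)"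
      using w(2) by linarith
    also have "\<dots> = real (Suc (Suc n)) * (B\<^sup>2 + 1)" by (simp add: algebra_simps)
    finally have "(james_norm S (\<lambda>a. w a + z a))\<^sup>2 \<le> real (Suc (Suc n)) * (B\<^sup>2 + 1)" .
    moreover have "(1 / real (Suc (Suc n))) *\<^sub>R T (\<lambda>a. w a + z a) \<in> ?C"
    proof -
      \<comment> \<open>The new average is the old one with weight \<open>(n + 1) / (n + 2)\<close>
        together with \<open>T z\<close> with weight \<open>1 / (n + 2)\<close>.\<close>
      have "(real (Suc n) / real (Suc (Suc n))) *\<^sub>R ((1 / real (Suc n)) *\<^sub>R T w)
          + (1 / real (Suc (Suc n))) *\<^sub>R T z \<in> ?C"
        by (intro convexD[OF convex_convex_hull w(3) z(2)]) (auto simp: field_simps)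
      moreover have "real (Suc n) / real (Suc (Suc n)) * (1 / real (Suc n)) = 1 / real (Suc (Suc n))"
        by (simp add: divide_simps)
      ultimately show ?thesis
        by (simp only: T_add[OF w(1) z(1)] scaleR_add_right scaleR_scaleR)
    qed
    ultimately show ?case using fin_supp_add[OF w(1) z(1)] by blast
  qed
  note w = this
  have le: "c\<^sup>2 * real (Suc n) \<le> B\<^sup>2 + 1" for n
  proof -
    obtain w where w: "w \<in> fin_supp" "(james_norm S w)\<^sup>2 \<le> real (Suc n) * (B\<^sup>2 + 1)"
      "(1 / real (Suc n)) *\<^sub>R T w \<in> ?C" using w by blast
    have "c * real (Suc n) \<le> james_norm S w"
      using c[OF w(3)] by (simp add: norm_T[OF w(1)] pos_le_divide_eq)
    then have "(c * real (Suc n))\<^sup>2 \<le> real (Suc n) * (B\<^sup>2 + 1)"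
      using w(2) \<open>c > 0\<close> power_mono[of "c * real (Suc n)" "james_norm S w" 2] by simp
    then have "real (Suc n) * (c\<^sup>2 * real (Suc n)) \<le> real (Suc n) * (B\<^sup>2 + 1)"
      by (simp only: power2_eq_square ac_simps)
    then show ?thesis by (rule mult_left_le_imp_le) simp
  qed
  obtain n where "(B\<^sup>2 + 1) / c\<^sup>2 < real n" using reals_Archimedean2 by blast
  then have "B\<^sup>2 + 1 < c\<^sup>2 * real (Suc n)"
    using \<open>c > 0\<close> by (simp add: pos_divide_less_eq algebra_simps) (smt (verit) zero_less_power)
  then show False using le[of n] by linarith
qed

end

section \<open>Sequences equivalent to the unit vectors of \<open>\<ell>\<^sup>1\<close>\<close>

lemma finite_support_mem_l1: "finite F \<Longrightarrow> (\<lambda>n. if n \<in> F then a n else 0) \<in> l1"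
  unfolding l1_def by (auto intro!: summable_finite)

lemma l1_norm_finite: "finite F \<Longrightarrow> l1_norm (\<lambda>n. if n \<in> F then a n else 0) = (\<Sum>n\<in>F. \<bar>a n\<bar>)"
  unfolding l1_norm_def by (subst suminf_finite[of F]) auto

text \<open>The \<open>u n\<close> are the images of the unit vectors; only finite combinations
  matter later, so no infinite series in the range is needed.\<close>

lemma contains_l1_imp_l1_sequence:
  assumes "contains_l1 TYPE('b::real_normed_vector)"
  obtains u :: "nat \<Rightarrow> 'b::real_normed_vector" and c C where "c > 0" "\<And>n. norm (u n) \<le> C"
    "\<And>F a. finite F \<Longrightarrow> c * (\<Sum>n\<in>F. \<bar>a n\<bar>) \<le> norm (\<Sum>n\<in>F. a n *\<^sub>R u n)"
proof -
  obtain U :: "(nat \<Rightarrow> real) \<Rightarrow> 'b" and c C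
    where U: "\<forall>a\<in>l1. \<forall>b\<in>l1. U (\<lambda>n. a n + b n) = U a + U b"
      "\<forall>a\<in>l1. \<forall>r. U (\<lambda>n. r * a n) = r *\<^sub>R U a"
      "\<forall>a\<in>l1. c * l1_norm a \<le> norm (U a) \<and> norm (U a) \<le> C * l1_norm a"
      and "c > 0"
    using assms unfolding contains_l1_def by (elim exE conjE)
  note add = U(1)[rule_format] and scale = U(2)[rule_format] and le = U(3)[rule_format]
  define e where "e k = (\<lambda>n. if n \<in> {k} then 1 else 0 :: real)" for k :: nat
  have e: "e k \<in> l1" for k
    using finite_support_mem_l1[of "{k}" "\<lambda>_. 1"] by (simp add: e_def)
  have sum: "U (\<lambda>n. if n \<in> F then a n else 0) = (\<Sum>n\<in>F. a n *\<^sub>R U (e n))" if "finite F" for F a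
    using that
  proof (induction F)
    case empty
    show ?case using scale[OF e, of 0 0] by simp
  next
    case (insert k F)
    have "(\<lambda>n. if n \<in> insert k F then a n else 0) = (\<lambda>n. a k * e k n + (if n \<in> F then a n else 0))"
      using insert.hyps by (auto simp: e_def)
    moreover have "(\<lambda>n. a k * e k n) \<in> l1"
      using finite_support_mem_l1[of "{k}" "\<lambda>_. a k"] by (simp add: e_def if_distrib cong: if_cong)
    ultimately have "U (\<lambda>n. if n \<in> insert k F then a n else 0)
        = U (\<lambda>n. a k * e k n) + U (\<lambda>n. if n \<in> F then a n else 0)"
      using add finite_support_mem_l1[OF insert.hyps(1)] by simp
    then show ?case using insert by (simp add: scale[OF e])
  qed
  show ?thesis
  proof (rule that[OF \<open>c > 0\<close>])
    show "norm (U (e n)) \<le> C" for n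
    proof -
      have "l1_norm (e n) = 1" using l1_norm_finite[of "{n}" "\<lambda>_. 1"] by (simp add: e_def)
      then show ?thesis using le[OF e, of n] by simp
    qed
    show "c * (\<Sum>n\<in>F. \<bar>a n\<bar>) \<le> norm (\<Sum>n\<in>F. a n *\<^sub>R U (e n))" if "finite F" for F a
      using le[OF finite_support_mem_l1[OF that, of a]] sum[OF that, of a] l1_norm_finite[OF that, of a] by simp
  qed
qed

text \<open>Replacing \<open>u\<close> by \<open>w\<close> changes a combination by at most
  \<open>d\<close> times the sum of its absolute coefficients. This permits passing to finitely
  supported vectors.\<close>

lemma l1_lower_bound_perturb:
  fixes u w :: "nat \<Rightarrow> 'b::real_normed_vector"
  assumes u: "c * (\<Sum>n\<in>F. \<bar>a n\<bar>) \<le> norm (\<Sum>n\<in>F. a n *\<^sub>R u n)"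
    and w: "\<And>n. norm (w n - u n) \<le> d"
  shows "(c - d) * (\<Sum>n\<in>F. \<bar>a n\<bar>) \<le> norm (\<Sum>n\<in>F. a n *\<^sub>R w n)"
proof -
  have "norm ((\<Sum>n\<in>F. a n *\<^sub>R w n) - (\<Sum>n\<in>F. a n *\<^sub>R u n)) \<le> (\<Sum>n\<in>F. \<bar>a n\<bar> * d)"
    unfolding sum_subtractf[symmetric] scaleR_diff_right[symmetric]
    by (intro sum_norm_le) (simp add: mult_left_mono w)
  then have "norm (\<Sum>n\<in>F. a n *\<^sub>R u n) \<le> norm (\<Sum>n\<in>F. a n *\<^sub>R w n) + d * (\<Sum>n\<in>F. \<bar>a n\<bar>)"
    using norm_triangle_sub[of "\<Sum>n\<in>F. a n *\<^sub>R u n" "\<Sum>n\<in>F. a n *\<^sub>R w n"]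
    by (simp add: norm_minus_commute sum_distrib_left mult.commute)
  then show ?thesis using u by (simp add: left_diff_distrib)
qed

text \<open>The indices \<open>r (2 * k)\<close> and \<open>r (Suc (2 * k))\<close> are all
  distinct, so nothing cancels: a convex combination of the differences has absolute coefficients
  summing to 2 with respect to \<open>w\<close>.\<close>

lemma norm_convex_hull_differences_ge:
  fixes w :: "nat \<Rightarrow> 'b::real_normed_vector"
  assumes w: "\<And>F a. finite F \<Longrightarrow> c * (\<Sum>n\<in>F. \<bar>a n\<bar>) \<le> norm (\<Sum>n\<in>F. a n *\<^sub>R w n)" and "c > 0"
    and r: "strict_mono (r :: nat \<Rightarrow> nat)"
    and v: "v \<in> convex hull range (\<lambda>k. w (r (2 * k)) - w (r (Suc (2 * k))))"
  shows "c \<le> norm v"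
proof -
  let ?y = "\<lambda>k. w (r (2 * k)) - w (r (Suc (2 * k)))"
  \<comment> \<open>Coefficients are indexed by \<open>k\<close> and not by points, so coincidences
    among the \<open>?y k\<close> do no harm.\<close>
  let ?M = "{v. \<exists>F a. finite F \<and> (\<forall>k. 0 \<le> a k) \<and> sum a F = 1 \<and> v = (\<Sum>k\<in>F. a k *\<^sub>R ?y k)}"
  have "convex hull range ?y \<subseteq> ?M"
  proof (rule hull_minimal)
    show "range ?y \<subseteq> ?M"
    proof
      fix v assume "v \<in> range ?y"
      then obtain k where "v = ?y k" by blast
      then show "v \<in> ?M" by (intro CollectI exI[of _ "{k}"] exI[of _ "\<lambda>_. 1"]) simp
    qed
    show "convex ?M"
    proof (rule convexI)
      fix u v and s t :: real
      assume "u \<in> ?M" "v \<in> ?M" and st: "0 \<le> s" "0 \<le> t" "s + t = 1"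
      then obtain F a G b where F: "finite F" "\<forall>k. 0 \<le> a k" "sum a F = 1" "u = (\<Sum>k\<in>F. a k *\<^sub>R ?y k)"
        and G: "finite G" "\<forall>k. 0 \<le> b k" "sum b G = 1" "v = (\<Sum>k\<in>G. b k *\<^sub>R ?y k)" by auto
      define d where "d k = s * (if k \<in> F then a k else 0) + t * (if k \<in> G then b k else 0)" for k
      have "sum d (F \<union> G) = s * sum a F + t * sum b G"
        using F(1) G(1) by (simp add: d_def sum.distrib sum_distrib_left[symmetric] sum.If_cases Int_absorb1)
      moreover have "(\<Sum>k\<in>F \<union> G. d k *\<^sub>R ?y k) = s *\<^sub>R u + t *\<^sub>R v"
      proof -
        have "(\<Sum>k\<in>F \<union> G. d k *\<^sub>R ?y k) = (\<Sum>k\<in>F \<union> G. (if k \<in> F then (s * a k) *\<^sub>R ?y k else 0))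
            + (\<Sum>k\<in>F \<union> G. (if k \<in> G then (t * b k) *\<^sub>R ?y k else 0))"
          unfolding sum.distrib[symmetric] by (intro sum.cong) (auto simp: d_def scaleR_add_left)
        also have "\<dots> = s *\<^sub>R u + t *\<^sub>R v"
          using F(1) G(1) by (simp add: sum.If_cases Int_absorb1 F(4) G(4) scaleR_sum_right)
        finally show ?thesis .
      qed
      ultimately show "s *\<^sub>R u + t *\<^sub>R v \<in> ?M"
        using F G st by (intro CollectI exI[of _ "F \<union> G"] exI[of _ d]) (auto simp: d_def)
    qed
  qed
  then obtain F a where F: "finite F" "\<And>k. 0 \<le> a k" "sum a F = 1" "v = (\<Sum>k\<in>F. a k *\<^sub>R ?y k)"
    using v by blast
  let ?f = "\<lambda>k. r (2 * k)" and ?g = "\<lambda>k. r (Suc (2 * k))"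
  have r_eq: "r (2 * k) = r (2 * j) \<longleftrightarrow> k = j" "r (Suc (2 * k)) = r (Suc (2 * j)) \<longleftrightarrow> k = j"
    "r (2 * k) \<noteq> r (Suc (2 * j))" "r (Suc (2 * k)) \<noteq> r (2 * j)" for k j
  proof -
    have "2 * k \<noteq> Suc (2 * j)" "Suc (2 * k) \<noteq> 2 * j" by presburger+
    then show "r (2 * k) = r (2 * j) \<longleftrightarrow> k = j" "r (Suc (2 * k)) = r (Suc (2 * j)) \<longleftrightarrow> k = j"
      "r (2 * k) \<noteq> r (Suc (2 * j))" "r (Suc (2 * k)) \<noteq> r (2 * j)"
      by (simp_all only: strict_mono_eq[OF r]) simp_all
  qed
  have dis: "?f ` F \<inter> ?g ` F = {}" by (blast dest: r_eq(3)[THEN notE])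
  have injf: "inj_on ?f F" and injg: "inj_on ?g F"
    by (auto intro!: inj_onI simp only: r_eq)
  \<comment> \<open>The coefficient of \<open>w n\<close> after expanding all differences; by
    \<open>r_eq\<close> at most one summand is nonzero.\<close>
  define b where "b n = (\<Sum>k\<in>F. (if n = ?f k then a k else 0) - (if n = ?g k then a k else 0))" for n
  have bf: "b (?f k) = a k" if "k \<in> F" for k
    unfolding b_def r_eq using F(1) that by (simp add: r_eq(3))
  have bg: "b (?g k) = - a k" if "k \<in> F" for k
    unfolding b_def r_eq using F(1) that by (simp add: r_eq(4) sum_negf)
  let ?H = "?f ` F \<union> ?g ` F"
  have "(\<Sum>n\<in>?H. \<bar>b n\<bar>) = (\<Sum>k\<in>F. \<bar>b (?f k)\<bar>) + (\<Sum>k\<in>F. \<bar>b (?g k)\<bar>)"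
    using F(1) dis by (simp add: sum.union_disjoint sum.reindex[OF injf] sum.reindex[OF injg])
  also have "\<dots> = 2"
    using F(2,3) by (simp add: bf bg)
  finally have norm: "(\<Sum>n\<in>?H. \<bar>b n\<bar>) = 2" .
  have "(\<Sum>n\<in>?H. b n *\<^sub>R w n) = (\<Sum>k\<in>F. b (?f k) *\<^sub>R w (?f k)) + (\<Sum>k\<in>F. b (?g k) *\<^sub>R w (?g k))"
    using F(1) dis by (simp add: sum.union_disjoint sum.reindex[OF injf] sum.reindex[OF injg])
  also have "\<dots> = v"
    by (simp add: F(4) bf bg scaleR_diff_right sum_subtractf sum_negf)
  finally have "c * 2 \<le> norm v" using w[of ?H b] F(1) norm by simp
  then show ?thesis using \<open>c > 0\<close> by simp
qed

theorem theorem2p2: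
  fixes S :: "'a set set" and T :: "('a \<Rightarrow> real) \<Rightarrow> 'b::banach"
  assumes "countably_intersected S"
    and "is_james_completion S T"
  shows "\<not> contains_l1 TYPE('b)"
proof
  interpret james_completion S T
    using assms by (rule james_completion.intro)
  assume l1: "contains_l1 TYPE('b)"
  obtain u :: "nat \<Rightarrow> 'b" and c C where "c > 0" and C: "\<And>n. norm (u n) \<le> C"
    and u: "\<And>F a. finite F \<Longrightarrow> c * (\<Sum>n\<in>F. \<bar>a n\<bar>) \<le> norm (\<Sum>n\<in>F. a n *\<^sub>R u n)"
    by (rule contains_l1_imp_l1_sequence[OF l1]) (rule that)
  have "\<exists>x. \<forall>n. x n \<in> fin_supp \<and> norm (T (x n) - u n) \<le> c / 2"
  proof (intro choice allI)
    fix n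
    have "u n \<in> closure (T ` fin_supp)" by (simp add: dense)
    then have "\<exists>v\<in>T ` fin_supp. dist v (u n) < c / 2"
      unfolding closure_approachable using \<open>c > 0\<close> by (elim allE[of _ "c / 2"]) simp
    then show "\<exists>\<phi>. \<phi> \<in> fin_supp \<and> norm (T \<phi> - u n) \<le> c / 2"
      by (auto simp: dist_norm intro: less_imp_le)
  qed
  then obtain x where x: "\<And>n. x n \<in> fin_supp" and xu: "\<And>n. norm (T (x n) - u n) \<le> c / 2"
    by auto
  \<comment> \<open>Approximation within \<open>c / 2\<close> leaves half of the lower
    constant.\<close>
  have lower: "c / 2 * (\<Sum>n\<in>F. \<bar>a n\<bar>) \<le> norm (\<Sum>n\<in>F. a n *\<^sub>R T (x n))" if "finite F" for F a
    using l1_lower_bound_perturb[OF u[OF that] xu] by simp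
  have xB: "norm (T (x n)) \<le> C + c / 2" for n
    using norm_triangle_sub[of "T (x n)" "u n"] C[of n] xu[of n] by simp
  obtain r :: "nat \<Rightarrow> nat" where r: "strict_mono r"
    and conv: "\<And>s. s \<in> S \<Longrightarrow> convergent (\<lambda>n. set_sum (x (r n)) s)"
  proof (rule pointwise_convergent_subseq[OF CI, of x "C + c / 2"])
    show "james_norm S (x n) \<le> C + c / 2" for n using xB[of n] by (simp add: norm_T x)
  qed (use x in auto)
  \<comment> \<open>Both terms have the same limit on each \<open>s\<close>, so the differences tend
    to 0 there without any limit functional being identified.\<close>
  define y where "y k a = x (r (2 * k)) a - x (r (Suc (2 * k))) a" for k a
  have y: "y k \<in> fin_supp" and Ty: "T (y k) = T (x (r (2 * k))) - T (x (r (Suc (2 * k))))" for k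
    unfolding y_def using x by (simp_all add: fin_supp_diff T_diff)
  have yB: "norm (T (y k)) \<le> 2 * (C + c / 2)" for k
    using norm_triangle_ineq4[of "T (x (r (2 * k)))" "T (x (r (Suc (2 * k))))"]
      xB[of "r (2 * k)"] xB[of "r (Suc (2 * k))"] by (simp add: Ty)
  have lim: "(\<lambda>k. set_sum (y k) s) \<longlonglongrightarrow> 0" if s: "s \<in> S" for s
  proof -
    obtain l where l: "(\<lambda>n. set_sum (x (r n)) s) \<longlonglongrightarrow> l" using conv[OF s] by (auto simp: convergent_def)
    have "strict_mono (\<lambda>k::nat. 2 * k)" "strict_mono (\<lambda>k::nat. Suc (2 * k))"
      by (simp_all add: strict_mono_def)
    then have "(\<lambda>k. set_sum (x (r (2 * k))) s) \<longlonglongrightarrow> l" "(\<lambda>k. set_sum (x (r (Suc (2 * k)))) s) \<longlonglongrightarrow> l"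
      using LIMSEQ_subseq_LIMSEQ[OF l] by (fastforce simp: comp_def)+
    from tendsto_diff[OF this] show ?thesis
      unfolding y_def by (simp add: set_sum_diff[OF x x])
  qed
  \<comment> \<open>By the lower estimate with constant \<open>c / 2\<close>, no convex combination
    of these differences can have norm below \<open>c / 2\<close>.\<close>
  obtain v where "v \<in> convex hull range (\<lambda>k. T (y k))" "norm v < c / 2"
    using convex_hull_not_bounded_away[of y "2 * (C + c / 2)" "c / 2", OF y yB lim] \<open>c > 0\<close> by auto
  then show False
    using norm_convex_hull_differences_ge[OF lower _ r, of v] \<open>c > 0\<close> by (simp add: Ty)
qed

end
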